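(* For every sufficiently large positive integer $N$, the flip graph of triangulations of the point set $\Pi=\Pi_N$ defined in the context is not connected. Equivalently, the flip graph of tight zonotopal tilings of the $3$-dimensional permutohedron in which each of its six generating vectors is repeated $2N+1$ times is not connected.
   Context: General conventions. For a finite point set $A\subset\mathbb R^d$: a cell is a subset of $A$; a simplex is an affinely independent cell; a face of a cell $C$ is a subset $F\subseteq C$ which is the set of minimizers on $C$ of some linear functional. A triangulation of $A$ is a collection $\mathscr T$ of simplices of $A$, closed under taking faces, such that for all $\sigma,\sigma'\in\mathscr T$, $\mathrm{conv}(\sigma)\cap\mathrm{conv}(\sigma')=\mathrm{conv}(F)$ for a common face $F$ of $\sigma$ and $\sigma'$, and such that $\bigcup_{\sigma\in\mathscr T}\mathrm{conv}(\sigma)=\mathrm{conv}(A)$. A circuit is a minimal affinely dependent subset $X$; it satisfies an affine dependence $\sum_{x\in X}\lambda_x x=0$, $\sum\lambda_x=0$, all $\lambda_x\neq0$, unique up to scaling, which partitions $X=X^+\cup X^-$ into the points with positive and with negative coefficients; writing $X=(X^+,X^-)$ fixes a choice of sign. Set $\mathscr T_X^+:=\{\sigma\subseteq X:X^+\not\subseteq\sigma\}$ and $\mathscr T_X^-:=\{\sigma\subseteq X:X^-\not\subseteq\sigma\}$ (the two triangulations of $X$). For $C\in\mathscr T$, $\mathrm{link}_{\mathscr T}(C):=\{C'\in\mathscr T: C\cap C'=\emptyset,\ C\cup C'\in\mathscr T\}$. A triangulation $\mathscr T$ of $A$ has a flip supported on the circuit $(X^+,X^-)$, $X\subseteq A$,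 if $\mathscr T_X^+\subseteq\mathscr T$ and all inclusion-maximal elements of $\mathscr T_X^+$ have the same link $\mathscr L$ in $\mathscr T$; the result of the flip is the triangulation $(\mathscr T\setminus\{\rho\cup\sigma:\rho\in\mathscr L,\sigma\in\mathscr T_X^+\})\cup\{\rho\cup\sigma:\rho\in\mathscr L,\sigma\in\mathscr T_X^-\}$. The flip graph of $A$ has the triangulations of $A$ as vertices, with $\mathscr T,\mathscr T'$ adjacent when one is the result of a flip on the other. The point set $\Pi$. Let $e_1,\dots,e_4$ be the standard basis of $\mathbb R^4$. For distinct $i,j\in[4]$ and integers $-N\le r\le N$ introduce symbols $f_{ij}^r$ with the identification $f_{ij}^r=f_{ji}^{-r}$; the $6(2N+1)$ distinct symbols $\{f_{ij}^r\}_{1\le i<j\le4,\,-N\le r\le N}$ form the standard basis of $\mathbb R^{6(2N+1)}$. Set $\Pi:=\bigcup_{1\le i<j\le4}\bigcup_{-N\le r\le N}\{(e_i,f_{ij}^r),(e_j,f_{ij}^r)\}\subset\mathbb R^4\times\mathbb R^{6(2N+1)}$. (By the Cayley trick, $\Pi$ is the Cayley embedding of the zonotope $\sum_{i<j}\sum_{r}[e_i,e_j]$; its triangulations correspond to the fine (tight) zonotopal tilings of that zonotope, and flips of tilings are defined as flips of the corresponding triangulations.) *)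

theory Defs
  imports Complex_Main
begin

text \<open>Points are finitely supported real-valued functions on a coordinate type 'c
  (a point of R^D is a function D \<rightarrow> real).  All affine notions are written out
  explicitly in coordinates.\<close>

text \<open>Convex hull of a finite point set.\<close>
definition conv :: "('c \<Rightarrow> real) set \<Rightarrow> ('c \<Rightarrow> real) set" where
  "conv S = {p. \<exists>\<mu>. (\<forall>x\<in>S. 0 \<le> \<mu> x) \<and> (\<Sum>x\<in>S. \<mu> x) = 1 \<and> p = (\<lambda>c. \<Sum>x\<in>S. \<mu> x * x c)}"

definition aff_dependent :: "('c \<Rightarrow> real) set \<Rightarrow> bool" where
  "aff_dependent S \<longleftrightarrow> (\<exists>T \<subseteq> S. finite T \<and> (\<exists>\<mu>. (\<Sum>x\<in>T. \<mu> x) = 0 \<and>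
      (\<forall>c. (\<Sum>x\<in>T. \<mu> x * x c) = 0) \<and> (\<exists>x\<in>T. \<mu> x \<noteq> 0)))"

text \<open>Linear functional with coefficient vector w, evaluated at a finitely supported point p.\<close>
definition lin_fun :: "('c \<Rightarrow> real) \<Rightarrow> ('c \<Rightarrow> real) \<Rightarrow> real" where
  "lin_fun w p = (\<Sum>c | p c \<noteq> 0. w c * p c)"

text \<open>Faces: sets of minimizers of a linear functional; the empty set is also a face.\<close>
definition is_face :: "('c \<Rightarrow> real) set \<Rightarrow> ('c \<Rightarrow> real) set \<Rightarrow> bool" where
  "is_face C F \<longleftrightarrow> F = {} \<or>
     (\<exists>w. F = {x \<in> C. \<forall>y\<in>C. lin_fun w x \<le> lin_fun w y})"

definition is_simplex :: "('c \<Rightarrow> real) set \<Rightarrow> ('c \<Rightarrow> real) set \<Rightarrow> bool" where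
  "is_simplex A \<sigma> \<longleftrightarrow> \<sigma> \<subseteq> A \<and> \<not> aff_dependent \<sigma>"

definition triangulation :: "('c \<Rightarrow> real) set \<Rightarrow> ('c \<Rightarrow> real) set set \<Rightarrow> bool" where
  "triangulation A T \<longleftrightarrow>
     (\<forall>\<sigma>\<in>T. is_simplex A \<sigma>) \<and>
     (\<forall>\<sigma>\<in>T. \<forall>F. F \<subseteq> \<sigma> \<longrightarrow> is_face \<sigma> F \<longrightarrow> F \<in> T) \<and>
     (\<forall>\<sigma>\<in>T. \<forall>\<sigma>'\<in>T. \<exists>F. is_face \<sigma> F \<and> is_face \<sigma>' F \<and> conv \<sigma> \<inter> conv \<sigma>' = conv F) \<and>
     \<Union> (conv ` T) = conv A"

definition is_circuit :: "('c \<Rightarrow> real) set \<Rightarrow> bool" where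
  "is_circuit X \<longleftrightarrow> aff_dependent X \<and> (\<forall>Y. Y \<subset> X \<longrightarrow> \<not> aff_dependent Y)"

text \<open>Signed circuit (X+, X-) contained in A.\<close>
definition signed_circuit :: "('c \<Rightarrow> real) set \<Rightarrow> ('c \<Rightarrow> real) set \<Rightarrow> ('c \<Rightarrow> real) set \<Rightarrow> bool" where
  "signed_circuit A Xp Xm \<longleftrightarrow> Xp \<union> Xm \<subseteq> A \<and> is_circuit (Xp \<union> Xm) \<and> Xp \<inter> Xm = {} \<and>
     (\<exists>lam. (\<Sum>x\<in>Xp \<union> Xm. lam x) = 0 \<and> (\<forall>c. (\<Sum>x\<in>Xp \<union> Xm. lam x * x c) = 0) \<and>
          (\<forall>x\<in>Xp. lam x > 0) \<and> (\<forall>x\<in>Xm. lam x < 0))"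

definition circ_tri :: "'a set \<Rightarrow> 'a set \<Rightarrow> 'a set set" where
  "circ_tri X Y = {\<sigma>. \<sigma> \<subseteq> X \<and> \<not> Y \<subseteq> \<sigma>}"

text \<open>T_X^+ = circ_tri X X+,  T_X^- = circ_tri X X-.\<close>

definition link :: "'a set set \<Rightarrow> 'a set \<Rightarrow> 'a set set" where
  "link T C = {C' \<in> T. C \<inter> C' = {} \<and> C \<union> C' \<in> T}"

definition flip_step :: "('c \<Rightarrow> real) set \<Rightarrow> ('c \<Rightarrow> real) set set \<Rightarrow> ('c \<Rightarrow> real) set set \<Rightarrow> bool" where
  "flip_step A T T' \<longleftrightarrow> (\<exists>Xp Xm L.
     signed_circuit A Xp Xm \<and>
     circ_tri (Xp \<union> Xm) Xp \<subseteq> T \<and>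
     (\<forall>\<sigma>\<in>circ_tri (Xp \<union> Xm) Xp.
        (\<forall>\<tau>\<in>circ_tri (Xp \<union> Xm) Xp. \<sigma> \<subseteq> \<tau> \<longrightarrow> \<tau> = \<sigma>) \<longrightarrow> link T \<sigma> = L) \<and>
     T' = (T - {\<rho> \<union> \<sigma> | \<rho> \<sigma>. \<rho> \<in> L \<and> \<sigma> \<in> circ_tri (Xp \<union> Xm) Xp})
          \<union> {\<rho> \<union> \<sigma> | \<rho> \<sigma>. \<rho> \<in> L \<and> \<sigma> \<in> circ_tri (Xp \<union> Xm) Xm})"

definition flip_adj :: "('c \<Rightarrow> real) set \<Rightarrow> (('c \<Rightarrow> real) set set \<times> ('c \<Rightarrow> real) set set) set" where
  "flip_adj A = {(T, T'). triangulation A T \<and> triangulation A T' \<and>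
                          (flip_step A T T' \<or> flip_step A T' T)}"

definition flip_graph_connected :: "('c \<Rightarrow> real) set \<Rightarrow> bool" where
  "flip_graph_connected A \<longleftrightarrow>
     (\<forall>T T'. triangulation A T \<longrightarrow> triangulation A T' \<longrightarrow> (T, T') \<in> (flip_adj A)\<^sup>*)"

text \<open>Coordinates of R^4 x R^(6(2N+1)): E i is e_i, F i j r (i<j) is f_ij^r.\<close>
datatype coord = E nat | F nat nat int

definition pt :: "nat \<Rightarrow> nat \<Rightarrow> nat \<Rightarrow> int \<Rightarrow> coord \<Rightarrow> real" where
  "pt k i j r = (\<lambda>c. if c = E k \<or> c = F i j r then 1 else 0)"

text \<open>pt k i j r is the point (e_k, f_ij^r).\<close>

definition Pi_set :: "nat \<Rightarrow> (coord \<Rightarrow> real) set" where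
  "Pi_set N = (\<Union>i\<in>{1..4}. \<Union>j\<in>{1..4}. \<Union>r\<in>{-int N..int N}.
      if i < j then {pt i i j r, pt j i j r} else {})"

end

theory Submission
  imports Defs "HOL-Analysis.Function_Topology"
begin

text \<open>Consider the affine arrangement of the planes x_i - x_j = r with r between -N and N. A
  triangle circuit on f_ij^r, f_jk^s, f_ki^t with r + s + t = 0 is a line of this arrangement, and
  every triangulation contains exactly one of its two halves, which gives the line a sign. Four such
  lines pass through an integer vertex x. With signs oriented as the boundary of a tetrahedron, the
  barycentre of the twelve points tight at x shows that the four signs are never all equal. A flip
  changes the sign of at most one line, so a line cannot change its sign if at one of its vertices
  the three other lines all have the opposite sign. If every line is blocked in this way, then no
  sequence of flips changes any sign.

  Such signs are given by products of square waves of periods 2, 4 and 8 in the differences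
  x_i - x_j, one period for each perfect matching of the complete graph on 4 vertices; the product
  of the four signs at a vertex is always -1, so that one or three of them are negative. To realise
  them by a triangulation, refine the regular subdivision dual to the arrangement at each vertex x
  by a generic height function that depends on x and has the prescribed sign on the four lines. The
  heights at different vertices need not fit together, but on a circuit common to several vertices
  they have the same sign, and this is enough. The negated signs give a second triangulation, in
  another component.\<close>

section \<open>Faces of simplices\<close>

text \<open>The two triangulations cannot both be regular, since regular triangulations are joined
  to each other by flips; this is why the heights vary with the vertex instead of coming from one
  height function.

  Gluing such heights works because affine dependences of the point set are circulations on the
  complete graph on 4 vertices with parallel arcs, so the positive arcs of a nonzero one contain a
  directed cycle of length 2, 3 or 4. Tightness on a 3-cycle fixes a line but not a vertex on it,
  and this is where heights of different vertices meet. Tightness on a 4-cycle fixes the vertex up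
  to translation, so there the height only has to be nonzero. Hence the two conditions on the local
  heights: the sum over a facet has a sign that depends only on its line, and no two of the four
  facet sums at a vertex cancel.

  The bound 7 on N leaves room on every line for eight consecutive vertices, one full period of the
  longest wave.\<close>

lemma vanishing_functional:
  fixes v :: "'c \<Rightarrow> real"
  assumes "finite S" "finite C"
    and "\<not> (\<exists>\<mu>. \<forall>c\<in>C. v c = (\<Sum>x\<in>S. \<mu> x * x c))"
  shows "\<exists>w. (\<forall>x\<in>S. (\<Sum>c\<in>C. w c * x c) = 0) \<and> (\<Sum>c\<in>C. w c * v c) = 1"
  using assms(1,3)
proof (induction S arbitrary: v rule: finite_induct)
  case empty
  then obtain c where c: "c \<in> C" "v c \<noteq> 0" by auto
  have "(\<Sum>b\<in>C. (if b = c then 1 / v c else 0) * v b) = 1"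
    using c \<open>finite C\<close> by (simp add: if_distrib [of "\<lambda>t. t * _"] sum.delta cong: if_cong)
  then show ?case by (intro exI[of _ "\<lambda>b. if b = c then 1 / v c else 0"]) simp
next
  case (insert s S)
  show ?case
  proof (cases "\<exists>\<mu>. \<forall>c\<in>C. s c = (\<Sum>x\<in>S. \<mu> x * x c)")
    case True
    then obtain \<mu> where \<mu>: "\<And>c. c \<in> C \<Longrightarrow> s c = (\<Sum>x\<in>S. \<mu> x * x c)" by blast
    have "\<not> (\<exists>\<nu>. \<forall>c\<in>C. v c = (\<Sum>x\<in>S. \<nu> x * x c))"
    proof
      assume "\<exists>\<nu>. \<forall>c\<in>C. v c = (\<Sum>x\<in>S. \<nu> x * x c)"
      then obtain \<nu> where \<nu>: "\<forall>c\<in>C. v c = (\<Sum>x\<in>S. \<nu> x * x c)" by blast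
      have "(\<Sum>x\<in>insert s S. (\<nu>(s := 0)) x * x c) = (\<Sum>x\<in>S. \<nu> x * x c)" for c
        using insert.hyps by (simp, intro sum.cong) auto
      then have "\<forall>c\<in>C. v c = (\<Sum>x\<in>insert s S. (\<nu>(s := 0)) x * x c)"
        using \<nu> by (simp del: fun_upd_apply)
      then show False using insert.prems by blast
    qed
    then obtain w where w: "\<And>x. x \<in> S \<Longrightarrow> (\<Sum>c\<in>C. w c * x c) = 0" "(\<Sum>c\<in>C. w c * v c) = 1"
      using insert.IH by blast
    have "(\<Sum>c\<in>C. w c * s c) = (\<Sum>c\<in>C. \<Sum>x\<in>S. \<mu> x * (w c * x c))"
      by (intro sum.cong) (auto simp: \<mu> sum_distrib_left mult_ac)
    also have "\<dots> = (\<Sum>x\<in>S. \<mu> x * (\<Sum>c\<in>C. w c * x c))"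
      by (subst sum.swap) (simp add: sum_distrib_left)
    also have "\<dots> = 0" by (simp add: w)
    finally show ?thesis using w by (intro exI[of _ w]) auto
  next
    case False
    then obtain a where a: "\<And>x. x \<in> S \<Longrightarrow> (\<Sum>c\<in>C. a c * x c) = 0" "(\<Sum>c\<in>C. a c * s c) = 1"
      using insert.IH by blast
    \<comment> \<open>One elimination step: \<open>a\<close> is dual to \<open>s\<close>, and v - t
      s is the part of \<open>v\<close> that \<open>a\<close> does not see. The functional
      \<open>b\<close> found for it is corrected by a multiple of \<open>a\<close> so as to vanish
      at \<open>s\<close> too.\<close>
    define t where "t = (\<Sum>c\<in>C. a c * v c)"
    have "\<not> (\<exists>\<nu>. \<forall>c\<in>C. v c - t * s c = (\<Sum>x\<in>S. \<nu> x * x c))"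
    proof
      assume "\<exists>\<nu>. \<forall>c\<in>C. v c - t * s c = (\<Sum>x\<in>S. \<nu> x * x c)"
      then obtain \<nu> where \<nu>: "\<forall>c\<in>C. v c - t * s c = (\<Sum>x\<in>S. \<nu> x * x c)" by blast
      have "(\<Sum>x\<in>insert s S. (\<nu>(s := t)) x * x c) = t * s c + (\<Sum>x\<in>S. \<nu> x * x c)" for c
        using insert.hyps by (simp, intro sum.cong) auto
      then have "\<forall>c\<in>C. v c = (\<Sum>x\<in>insert s S. (\<nu>(s := t)) x * x c)"
        using \<nu> by (metis add.commute diff_add_cancel)
      then show False using insert.prems by blast
    qed
    then obtain b where b: "\<And>x. x \<in> S \<Longrightarrow> (\<Sum>c\<in>C. b c * x c) = 0"
        "(\<Sum>c\<in>C. b c * (v c - t * s c)) = 1"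
      using insert.IH[of "\<lambda>c. v c - t * s c"] by blast
    define u where "u = (\<Sum>c\<in>C. b c * s c)"
    have comb: "(\<Sum>c\<in>C. (b c - u * a c) * x c) = (\<Sum>c\<in>C. b c * x c) - u * (\<Sum>c\<in>C. a c * x c)" for x
      by (simp add: sum_distrib_left sum_subtractf algebra_simps)
    have "(\<Sum>c\<in>C. b c * v c) - t * u = 1"
      using b(2) by (simp add: u_def sum_distrib_left sum_subtractf algebra_simps)
    then have "(\<Sum>c\<in>C. (b c - u * a c) * v c) = 1"
      unfolding comb t_def[symmetric] by (simp add: mult.commute)
    moreover have "\<forall>x\<in>insert s S. (\<Sum>c\<in>C. (b c - u * a c) * x c) = 0"
      unfolding comb using a b by (auto simp: u_def)
    ultimately show ?thesis by (intro exI[of _ "\<lambda>c. b c - u * a c"] conjI)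
  qed
qed

lemma lin_fun_eq:
  assumes "finite C" "\<And>c. p c \<noteq> 0 \<Longrightarrow> c \<in> C"
  shows "lin_fun w p = (\<Sum>c\<in>C. w c * p c)"
  unfolding lin_fun_def using assms by (intro sum.mono_neutral_left) auto

text \<open>Since \<open>h\<close> puts the points on a hyperplane missing the origin, affine
  independence is linear independence and every vertex has a dual functional. The sum of those dual
  to the vertices outside \<open>G\<close> is 0 on \<open>G\<close> and 1 on the rest.\<close>

lemma subset_simplex_face:
  fixes \<sigma> :: "('c \<Rightarrow> real) set"
  assumes fin: "finite \<sigma>" "finite C" "\<And>x c. x \<in> \<sigma> \<Longrightarrow> x c \<noteq> 0 \<Longrightarrow> c \<in> C"
    and aff: "\<And>x. x \<in> \<sigma> \<Longrightarrow> (\<Sum>c\<in>C. h c * x c) = 1"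
    and indep: "\<not> aff_dependent \<sigma>" and G: "G \<subseteq> \<sigma>"
  shows "is_face \<sigma> G"
proof (cases "G = {}")
  case False
  have "\<exists>w. (\<forall>y\<in>\<sigma> - {x}. (\<Sum>c\<in>C. w c * y c) = 0) \<and> (\<Sum>c\<in>C. w c * x c) = 1" if x: "x \<in> \<sigma>" for x
  proof (rule vanishing_functional)
    show "\<not> (\<exists>\<mu>. \<forall>c\<in>C. x c = (\<Sum>y\<in>\<sigma> - {x}. \<mu> y * y c))"
    proof
      assume "\<exists>\<mu>. \<forall>c\<in>C. x c = (\<Sum>y\<in>\<sigma> - {x}. \<mu> y * y c)"
      then obtain \<mu> where \<mu>: "\<And>c. c \<in> C \<Longrightarrow> x c = (\<Sum>y\<in>\<sigma> - {x}. \<mu> y * y c)" by blast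
      define \<nu> where "\<nu> = \<mu>(x := -1)"
      have split: "(\<Sum>y\<in>\<sigma>. \<nu> y * f y) = (\<Sum>y\<in>\<sigma> - {x}. \<mu> y * f y) - f x" for f
        using fin(1) x by (simp add: \<nu>_def sum.remove[of \<sigma> x])
      have coord: "(\<Sum>y\<in>\<sigma>. \<nu> y * y c) = 0" for c
      proof (cases "c \<in> C")
        case True
        then show ?thesis using \<mu>[OF True] by (simp add: split[of "\<lambda>y. y c"])
      next
        case False
        then have "y c = 0" if "y \<in> \<sigma>" for y using fin(3) that by blast
        then show ?thesis by (intro sum.neutral) simp
      qed
      have "(\<Sum>y\<in>\<sigma>. \<nu> y) = (\<Sum>y\<in>\<sigma>. \<Sum>c\<in>C. h c * (\<nu> y * y c))"
      proof (rule sum.cong[OF refl])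
        fix y assume "y \<in> \<sigma>"
        then have "\<nu> y = \<nu> y * (\<Sum>c\<in>C. h c * y c)" using aff by simp
        then show "\<nu> y = (\<Sum>c\<in>C. h c * (\<nu> y * y c))"
          by (simp add: sum_distrib_left mult_ac)
      qed
      also have "\<dots> = (\<Sum>c\<in>C. h c * (\<Sum>y\<in>\<sigma>. \<nu> y * y c))"
        by (subst sum.swap) (simp only: sum_distrib_left)
      also have "\<dots> = 0" by (simp only: coord) simp
      finally have "aff_dependent \<sigma>"
        unfolding aff_dependent_def using fin(1) coord x
        by (intro exI[of _ \<sigma>] conjI exI[of _ \<nu>] bexI[of _ x]) (auto simp: \<nu>_def)
      with indep show False ..
    qed
  qed (use fin in auto)
  then have ex: "\<forall>x\<in>\<sigma>. \<exists>w. (\<forall>y\<in>\<sigma> - {x}. (\<Sum>c\<in>C. w c * y c) = 0) \<and> (\<Sum>c\<in>C. w c * x c) = 1"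
    by blast
  obtain w where w: "\<And>x y. x \<in> \<sigma> \<Longrightarrow> y \<in> \<sigma> \<Longrightarrow> (\<Sum>c\<in>C. w x c * y c) = (if y = x then 1 else 0)"
  proof -
    from bchoice[OF ex] obtain w where w: "\<forall>x\<in>\<sigma>.
        (\<forall>y\<in>\<sigma> - {x}. (\<Sum>c\<in>C. w x c * y c) = 0) \<and> (\<Sum>c\<in>C. w x c * x c) = 1"
      by (elim exE)
    show thesis
    proof (rule that)
      fix x y assume "x \<in> \<sigma>" "y \<in> \<sigma>"
      then show "(\<Sum>c\<in>C. w x c * y c) = (if y = x then 1 else 0)"
        using bspec[OF w, of x] by (cases "y = x") simp_all
    qed
  qed
  define W where "W = (\<lambda>c. \<Sum>x\<in>\<sigma> - G. w x c)"
  have val: "lin_fun W y = (if y \<in> G then 0 else 1)" if y: "y \<in> \<sigma>" for y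
  proof -
    have "lin_fun W y = (\<Sum>c\<in>C. \<Sum>x\<in>\<sigma> - G. w x c * y c)"
      using fin y by (subst lin_fun_eq[of C]) (auto simp: W_def sum_distrib_right)
    also have "\<dots> = (\<Sum>x\<in>\<sigma> - G. if y = x then 1 else 0)"
      using w y by (subst sum.swap) (auto intro!: sum.cong)
    finally show ?thesis using fin y by (simp add: sum.delta)
  qed
  have "G = {x \<in> \<sigma>. \<forall>y\<in>\<sigma>. lin_fun W x \<le> lin_fun W y}"
  proof (intro set_eqI iffI)
    fix x assume "x \<in> G"
    then show "x \<in> {x \<in> \<sigma>. \<forall>y\<in>\<sigma>. lin_fun W x \<le> lin_fun W y}" using G val by auto
  next
    fix x assume x: "x \<in> {x \<in> \<sigma>. \<forall>y\<in>\<sigma>. lin_fun W x \<le> lin_fun W y}"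
    obtain y where y: "y \<in> G" using False by blast
    then have "lin_fun W x \<le> lin_fun W y" "x \<in> \<sigma>" "lin_fun W y = 0"
      using x G val[of y] by auto
    then show "x \<in> G" using val[of x] by (simp split: if_splits)
  qed
  then show ?thesis unfolding is_face_def by blast
qed (simp add: is_face_def)

section \<open>Points as arcs\<close>

text \<open>The arc (i, j, r) stands for the point (e_i, f_ij^r), where f_ij^r = f_ji^(-r); its
  reversal (j, i, -r) is the other point on the same f.\<close>

definition edge_pt :: "nat \<Rightarrow> nat \<Rightarrow> int \<Rightarrow> coord \<Rightarrow> real" where
  "edge_pt i j r = (if i < j then pt i i j r else pt i j i (- r))"

definition arcs :: "nat \<Rightarrow> (nat \<times> nat \<times> int) set" where
  "arcs N = {(i, j, r). i \<in> {1..4} \<and> j \<in> {1..4} \<and> i \<noteq> j \<and> \<bar>r\<bar> \<le> int N}"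

definition arc_pt :: "nat \<times> nat \<times> int \<Rightarrow> coord \<Rightarrow> real" where
  "arc_pt = (\<lambda>(i, j, r). edge_pt i j r)"

definition arc_rev :: "nat \<times> nat \<times> int \<Rightarrow> nat \<times> nat \<times> int" where
  "arc_rev = (\<lambda>(i, j, r). (j, i, - r))"

text \<open>A finite set containing the support of every point. It also holds the symbols
  \<open>F i j r\<close> with i \<ge> j, at which every point vanishes.\<close>

definition coords :: "nat \<Rightarrow> coord set" where
  "coords N = E ` {1..4} \<union> (\<lambda>(i, j, r). F i j r) ` ({1..4} \<times> {1..4} \<times> {-int N..int N})"

lemma arc_pt_simp [simp]: "arc_pt (i, j, r) = edge_pt i j r"
  by (simp add: arc_pt_def)

lemma arc_rev_simp [simp]: "arc_rev (i, j, r) = (j, i, - r)"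
  by (simp add: arc_rev_def)

lemma arc_rev_rev [simp]: "arc_rev (arc_rev a) = a"
  by (cases a) simp

lemma arc_rev_arcs [simp]: "arc_rev a \<in> arcs N \<longleftrightarrow> a \<in> arcs N"
  by (cases a) (auto simp: arcs_def)

lemma finite_arcs [simp]: "finite (arcs N)"
proof (rule finite_subset)
  show "arcs N \<subseteq> {1..4} \<times> {1..4} \<times> {-int N..int N}" by (auto simp: arcs_def)
qed simp

lemma finite_coords [simp]: "finite (coords N)"
  by (simp add: coords_def)

lemma coords_simps [simp]:
  "E k \<in> coords N \<longleftrightarrow> k \<in> {1..4}"
  "F i j r \<in> coords N \<longleftrightarrow> i \<in> {1..4} \<and> j \<in> {1..4} \<and> \<bar>r\<bar> \<le> int N"
  unfolding coords_def by (force, force simp: image_iff)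

lemma edge_pt_E [simp]: "edge_pt i j r (E k) = (if k = i then 1 else 0)"
  by (simp add: edge_pt_def pt_def)

lemma edge_pt_F: "i \<noteq> j \<Longrightarrow> edge_pt i j r (F k l s) =
    (if k < l \<and> ((i, j, r) = (k, l, s) \<or> (i, j, r) = (l, k, - s)) then 1 else 0)"
  by (auto simp: edge_pt_def pt_def)

lemma edge_pt_inject: "i \<noteq> j \<Longrightarrow> k \<noteq> l \<Longrightarrow> edge_pt i j r = edge_pt k l s \<longleftrightarrow> i = k \<and> j = l \<and> r = s"
proof
  assume ne: "i \<noteq> j" "k \<noteq> l" and eq: "edge_pt i j r = edge_pt k l s"
  have "i = k" using fun_cong[OF eq, of "E i"] by (simp split: if_splits)
  show "i = k \<and> j = l \<and> r = s"
  proof (cases "i < j")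
    case True
    then show ?thesis using fun_cong[OF eq, of "F i j r"] ne \<open>i = k\<close>
      by (auto simp: edge_pt_F split: if_splits)
  next
    case False
    then have "j < i" using ne by simp
    then show ?thesis using fun_cong[OF eq, of "F j i (- r)"] ne \<open>i = k\<close>
      by (auto simp: edge_pt_F split: if_splits)
  qed
qed simp

lemma inj_arc_pt: "inj_on arc_pt (arcs N)"
  by (auto simp: inj_on_def arcs_def edge_pt_inject)

lemma Pi_set_eq: "Pi_set N = arc_pt ` arcs N"
proof
  show "Pi_set N \<subseteq> arc_pt ` arcs N"
  proof
    fix x assume "x \<in> Pi_set N"
    then obtain i j r where r: "i \<in> {1..4}" "j \<in> {1..4}" "r \<in> {-int N..int N}" "i < j"
      and x: "x = pt i i j r \<or> x = pt j i j r"
      by (auto simp: Pi_set_def split: if_splits)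
    have "pt i i j r = arc_pt (i, j, r)" "pt j i j r = arc_pt (j, i, - r)"
      using r by (auto simp: edge_pt_def)
    moreover have "(i, j, r) \<in> arcs N" "(j, i, - r) \<in> arcs N"
      using r by (auto simp: arcs_def)
    ultimately show "x \<in> arc_pt ` arcs N" using x by blast
  qed
  show "arc_pt ` arcs N \<subseteq> Pi_set N"
  proof clarify
    fix i j r assume a: "(i, j, r) \<in> arcs N"
    show "arc_pt (i, j, r) \<in> Pi_set N"
    proof (cases "i < j")
      case True
      then show ?thesis using a unfolding Pi_set_def arcs_def
        by (intro UN_I[of i] UN_I[of j] UN_I[of r]) (auto simp: edge_pt_def)
    next
      case False
      then have "j < i" using a by (auto simp: arcs_def)
      then show ?thesis using a unfolding Pi_set_def arcs_def
        by (intro UN_I[of j] UN_I[of i] UN_I[of "- r"]) (auto simp: edge_pt_def)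
    qed
  qed
qed

lemma finite_Pi_set [simp]: "finite (Pi_set N)"
  by (simp add: Pi_set_eq)

lemma sum_Pi_set: "(\<Sum>x\<in>Pi_set N. f x) = (\<Sum>a\<in>arcs N. f (arc_pt a))"
  unfolding Pi_set_eq by (rule sum.reindex_cong[OF inj_arc_pt refl refl])

lemma edge_pt_in_Pi_set: "(i, j, r) \<in> arcs N \<Longrightarrow> edge_pt i j r \<in> Pi_set N"
  unfolding Pi_set_eq by force

lemma Pi_set_coords:
  assumes "x \<in> Pi_set N" "x c \<noteq> 0"
  shows "c \<in> coords N"
proof -
  obtain i j r where "(i, j, r) \<in> arcs N" "x = edge_pt i j r"
    using assms unfolding Pi_set_eq by auto
  then show ?thesis using assms(2)
    by (cases c) (auto simp: arcs_def edge_pt_F split: if_splits)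
qed

lemma Pi_set_height:
  assumes "x \<in> Pi_set N"
  shows "(\<Sum>c\<in>coords N. (case c of E _ \<Rightarrow> 1 | F _ _ _ \<Rightarrow> 0) * x c) = 1"
proof -
  obtain i j r where a: "(i, j, r) \<in> arcs N" "x = edge_pt i j r"
    using assms unfolding Pi_set_eq by auto
  have "(\<Sum>c\<in>coords N. (case c of E _ \<Rightarrow> 1 | F _ _ _ \<Rightarrow> 0) * x c)
      = (\<Sum>c\<in>{E i}. (case c of E _ \<Rightarrow> 1 | F _ _ _ \<Rightarrow> 0) * x c)"
  proof (rule sum.mono_neutral_right)
    show "{E i} \<subseteq> coords N" using a by (auto simp: arcs_def)
    show "\<forall>c\<in>coords N - {E i}. (case c of E _ \<Rightarrow> 1 | F _ _ _ \<Rightarrow> 0) * x c = 0"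
      using a by (auto split: coord.splits)
  qed simp
  then show ?thesis using a by simp
qed

lemma sum_Pi_set_E:
  "(\<Sum>x\<in>Pi_set N. d x * x (E k)) = (\<Sum>a | a \<in> arcs N \<and> fst a = k. d (arc_pt a))"
proof -
  have "(\<Sum>x\<in>Pi_set N. d x * x (E k)) = (\<Sum>a\<in>arcs N. if fst a = k then d (arc_pt a) else 0)"
    unfolding sum_Pi_set by (intro sum.cong) auto
  also have "\<dots> = (\<Sum>a | a \<in> arcs N \<and> fst a = k. d (arc_pt a))"
    by (rule sum.inter_filter[symmetric]) simp
  finally show ?thesis .
qed

text \<open>Only an arc and its reversal are nonzero at a given f, and only the arcs leaving
  \<open>k\<close> at \<open>E k\<close>. So an affine dependence is an antisymmetric function on
  arcs with zero net flow at every vertex, a circulation.\<close>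

lemma sum_Pi_set_F:
  assumes "(i, j, r) \<in> arcs N" "i < j"
  shows "(\<Sum>x\<in>Pi_set N. d x * x (F i j r)) = d (edge_pt i j r) + d (edge_pt j i (- r))"
proof -
  have "(\<Sum>x\<in>Pi_set N. d x * x (F i j r)) = (\<Sum>a\<in>{(i, j, r), (j, i, - r)}. d (arc_pt a) * arc_pt a (F i j r))"
    unfolding sum_Pi_set
  proof (rule sum.mono_neutral_right)
    show "{(i, j, r), (j, i, - r)} \<subseteq> arcs N" using assms by (auto simp: arcs_def)
    show "\<forall>a\<in>arcs N - {(i, j, r), (j, i, - r)}. d (arc_pt a) * arc_pt a (F i j r) = 0"
      by (auto simp: arcs_def edge_pt_F split: if_splits)
  qed simp
  also have "\<dots> = d (edge_pt i j r) + d (edge_pt j i (- r))"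
    using assms by (simp add: edge_pt_F)
  finally show ?thesis .
qed

lemma sum_Pi_set_F_other:
  assumes "c \<notin> coords N \<or> (\<exists>i j r. c = F i j r \<and> \<not> i < j)"
  shows "(\<Sum>x\<in>Pi_set N. d x * x c) = 0"
proof (rule sum.neutral, safe)
  fix x assume x: "x \<in> Pi_set N"
  then obtain i j r where "(i, j, r) \<in> arcs N" "x = edge_pt i j r" unfolding Pi_set_eq by auto
  then have "x c = 0" using assms Pi_set_coords[OF x, of c] by (auto simp: arcs_def edge_pt_F)
  then show "d x * x c = 0" by simp
qed

lemma sum_Pi_set_eqI:
  assumes "\<And>k. k \<in> {1..4} \<Longrightarrow> (\<Sum>a | a \<in> arcs N \<and> fst a = k. f (arc_pt a)) = (\<Sum>a | a \<in> arcs N \<and> fst a = k. g (arc_pt a))"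
    and "\<And>i j r. (i, j, r) \<in> arcs N \<Longrightarrow> i < j \<Longrightarrow> f (edge_pt i j r) + f (edge_pt j i (- r)) = g (edge_pt i j r) + g (edge_pt j i (- r))"
  shows "(\<Sum>x\<in>Pi_set N. f x * x c) = (\<Sum>x\<in>Pi_set N. g x * x c)"
proof (cases "c \<notin> coords N \<or> (\<exists>i j r. c = F i j r \<and> \<not> i < j)")
  case True
  then show ?thesis by (simp add: sum_Pi_set_F_other)
next
  case False
  show ?thesis
  proof (cases c)
    case (E k)
    then show ?thesis using False assms(1)[of k] by (auto simp: sum_Pi_set_E)
  next
    case (F i j r)
    then have "(i, j, r) \<in> arcs N" "i < j" using False by (auto simp: arcs_def)
    then show ?thesis using F assms(2) by (simp add: sum_Pi_set_F)
  qed
qed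

section \<open>Faces and convex hulls inside the point set\<close>

lemma subset_simplex_face_Pi:
  assumes "is_simplex (Pi_set N) \<sigma>" "G \<subseteq> \<sigma>"
  shows "is_face \<sigma> G"
proof (rule subset_simplex_face[where C = "coords N"])
  have \<sigma>: "\<sigma> \<subseteq> Pi_set N" using assms by (simp add: is_simplex_def)
  show "finite \<sigma>" using \<sigma> finite_Pi_set by (rule finite_subset)
  show "c \<in> coords N" if "x \<in> \<sigma>" "x c \<noteq> 0" for x c using Pi_set_coords \<sigma> that by blast
  show "(\<Sum>c\<in>coords N. (case c of E _ \<Rightarrow> 1 | F _ _ _ \<Rightarrow> 0) * x c) = 1" if "x \<in> \<sigma>" for x
    using Pi_set_height \<sigma> that by blast
  show "\<not> aff_dependent \<sigma>" "G \<subseteq> \<sigma>" using assms by (auto simp: is_simplex_def)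
qed simp

lemma triangulation_subset:
  assumes "triangulation (Pi_set N) T" "\<sigma> \<in> T" "G \<subseteq> \<sigma>"
  shows "G \<in> T"
proof -
  have "is_simplex (Pi_set N) \<sigma>" and "\<forall>G. G \<subseteq> \<sigma> \<longrightarrow> is_face \<sigma> G \<longrightarrow> G \<in> T"
    using assms(1,2) by (simp_all add: triangulation_def)
  then show ?thesis using subset_simplex_face_Pi assms(3) by blast
qed

text \<open>Weights are extended by 0 to the whole point set, so that representations over different
  simplices can be subtracted.\<close>

lemma conv_subset_Pi:
  assumes "\<sigma> \<subseteq> Pi_set N" "p \<in> conv \<sigma>"
  obtains \<mu> where "\<And>x. 0 \<le> \<mu> x" "\<And>x. x \<notin> \<sigma> \<Longrightarrow> \<mu> x = 0" "(\<Sum>x\<in>Pi_set N. \<mu> x) = 1"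
    "\<And>c. p c = (\<Sum>x\<in>Pi_set N. \<mu> x * x c)"
proof -
  obtain \<nu> where \<nu>: "\<forall>x\<in>\<sigma>. 0 \<le> \<nu> x" "(\<Sum>x\<in>\<sigma>. \<nu> x) = 1" "p = (\<lambda>c. \<Sum>x\<in>\<sigma>. \<nu> x * x c)"
    using assms(2) unfolding conv_def by blast
  define \<mu> where "\<mu> = (\<lambda>x. if x \<in> \<sigma> then \<nu> x else 0)"
  have "(\<Sum>x\<in>Pi_set N. \<mu> x * f x) = (\<Sum>x\<in>\<sigma>. \<nu> x * f x)" for f
    using assms(1) by (intro sum.mono_neutral_cong_right) (auto simp: \<mu>_def)
  from this[of "\<lambda>_. 1"] this have "(\<Sum>x\<in>Pi_set N. \<mu> x) = 1" "p c = (\<Sum>x\<in>Pi_set N. \<mu> x * x c)" for c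
    using \<nu>(2) by (simp_all add: \<nu>(3))
  then show thesis using \<nu>(1) by (intro that[of \<mu>]) (auto simp: \<mu>_def)
qed

lemma conv_subset_PiI:
  assumes "\<sigma> \<subseteq> Pi_set N" "\<And>x. 0 \<le> \<mu> x" "\<And>x. x \<in> Pi_set N \<Longrightarrow> x \<notin> \<sigma> \<Longrightarrow> \<mu> x = 0" "(\<Sum>x\<in>Pi_set N. \<mu> x) = 1"
    "\<And>c. p c = (\<Sum>x\<in>Pi_set N. \<mu> x * x c)"
  shows "p \<in> conv \<sigma>"
proof -
  have "(\<Sum>x\<in>Pi_set N. \<mu> x * f x) = (\<Sum>x\<in>\<sigma>. \<mu> x * f x)" for f
    using assms by (intro sum.mono_neutral_right) auto
  from this[of "\<lambda>_. 1"] this show ?thesis unfolding conv_def using assms(2,4)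
    by (intro CollectI exI[of _ \<mu>]) (auto simp: assms(5))
qed

section \<open>Signs of triangle circuits\<close>

text \<open>The facet opposite to l of a tetrahedron, oriented as part of the boundary: every edge is
  traversed once in each direction.\<close>

definition face_adj :: "nat \<Rightarrow> nat \<times> nat \<times> nat" where
  "face_adj l = (if l = 1 then (3, 2, 4) else if l = 2 then (1, 3, 4)
     else if l = 3 then (2, 1, 4) else (1, 2, 3))"

text \<open>With \<open>tri_neg\<close>, the two parts of the triangle circuit. Only differences
  inside the facet enter, so both depend on the line through \<open>x\<close> in direction
  \<open>l\<close> and not on the vertex chosen on it.\<close>

definition tri_pos :: "(nat \<Rightarrow> int) \<Rightarrow> nat \<Rightarrow> (coord \<Rightarrow> real) set" where
  "tri_pos x l = (case face_adj l of (i, j, k) \<Rightarrow>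
     {edge_pt i j (x i - x j), edge_pt j k (x j - x k), edge_pt k i (x k - x i)})"

definition tri_neg :: "(nat \<Rightarrow> int) \<Rightarrow> nat \<Rightarrow> (coord \<Rightarrow> real) set" where
  "tri_neg x l = (case face_adj l of (i, j, k) \<Rightarrow>
     {edge_pt j i (x j - x i), edge_pt k j (x k - x j), edge_pt i k (x i - x k)})"

definition in_box :: "nat \<Rightarrow> (nat \<Rightarrow> int) \<Rightarrow> bool" where
  "in_box N x \<longleftrightarrow> (\<forall>i\<in>{1..4}. \<forall>j\<in>{1..4}. \<bar>x i - x j\<bar> \<le> int N)"

lemma atLeastAtMost_1_4: "{1..4::nat} = {1, 2, 3, 4}"
  by auto

lemma supported_sum_E:
  assumes S: "S \<subseteq> arcs N" and z: "\<And>a. a \<in> arcs N \<Longrightarrow> a \<notin> S \<Longrightarrow> d (arc_pt a) = 0"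
  shows "(\<Sum>x\<in>Pi_set N. d x * x (E k)) = (\<Sum>a\<in>S. if fst a = k then d (arc_pt a) else 0)"
proof -
  have "(\<Sum>x\<in>Pi_set N. d x * x (E k)) = (\<Sum>a\<in>arcs N. if fst a = k then d (arc_pt a) else 0)"
    unfolding sum_Pi_set by (intro sum.cong) auto
  also have "\<dots> = (\<Sum>a\<in>S. if fst a = k then d (arc_pt a) else 0)"
    by (intro sum.mono_neutral_right) (use assms in auto)
  finally show ?thesis .
qed

lemma cover_obtain:
  assumes T: "triangulation (Pi_set N) T" and p: "p \<in> conv (Pi_set N)"
  obtains \<sigma> and \<mu> :: "(coord \<Rightarrow> real) \<Rightarrow> real" where "\<sigma> \<in> T" "\<And>x. 0 \<le> \<mu> x" "\<And>x. x \<in> Pi_set N \<Longrightarrow> \<mu> x \<noteq> 0 \<Longrightarrow> x \<in> \<sigma>"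
    "\<And>c. p c = (\<Sum>x\<in>Pi_set N. \<mu> x * x c)"
proof -
  have "\<Union> (conv ` T) = conv (Pi_set N)" using T by (simp add: triangulation_def)
  then obtain \<sigma> where \<sigma>: "\<sigma> \<in> T" "p \<in> conv \<sigma>" using p by blast
  have "\<sigma> \<subseteq> Pi_set N" using T \<sigma> by (simp add: triangulation_def is_simplex_def)
  from conv_subset_Pi[OF this \<sigma>(2)] obtain \<mu> where
    "\<And>x. 0 \<le> \<mu> x" "\<And>x. x \<notin> \<sigma> \<Longrightarrow> \<mu> x = 0" "\<And>c. p c = (\<Sum>x\<in>Pi_set N. \<mu> x * x c)"
    by metis
  then show thesis using \<sigma>(1) by (intro that[of \<sigma> \<mu>]) auto
qed


text \<open>Two representations of one point put equal mass on every f. Where that mass is 0,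
  nonnegativity makes both weights 0.\<close>

lemma same_point:
  fixes \<mu> \<mu>' :: "(coord \<Rightarrow> real) \<Rightarrow> real"
  assumes eq: "\<And>c. (\<Sum>x\<in>Pi_set N. \<mu> x * x c) = (\<Sum>x\<in>Pi_set N. \<mu>' x * x c)"
  shows same_point_pair: "a \<in> arcs N \<Longrightarrow> \<mu> (arc_pt a) + \<mu> (arc_pt (arc_rev a)) = \<mu>' (arc_pt a) + \<mu>' (arc_pt (arc_rev a))"
    and same_point_out: "(\<And>x. 0 \<le> \<mu> x) \<Longrightarrow> (\<And>a. a \<in> S \<Longrightarrow> arc_rev a \<in> S) \<Longrightarrow>
      (\<And>a. a \<in> arcs N \<Longrightarrow> a \<notin> S \<Longrightarrow> \<mu>' (arc_pt a) = 0) \<Longrightarrow> a \<in> arcs N \<Longrightarrow> a \<notin> S \<Longrightarrow> \<mu> (arc_pt a) = 0"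
proof -
  show pair: "\<mu> (arc_pt a) + \<mu> (arc_pt (arc_rev a)) = \<mu>' (arc_pt a) + \<mu>' (arc_pt (arc_rev a))"
    if a: "a \<in> arcs N" for a
  proof -
    obtain i j r where a': "a = (i, j, r)" by (cases a)
    show ?thesis
    proof (cases "i < j")
      case True
      then show ?thesis using eq[of "F i j r"] a by (simp add: a' sum_Pi_set_F)
    next
      case False
      then have "(j, i, - r) \<in> arcs N" "j < i" using a by (auto simp: a' arcs_def)
      then show ?thesis using eq[of "F j i (- r)"] by (simp add: a' sum_Pi_set_F add.commute)
    qed
  qed
  assume nn: "\<And>x. 0 \<le> \<mu> x" and rev: "\<And>a. a \<in> S \<Longrightarrow> arc_rev a \<in> S"
    and z: "\<And>a. a \<in> arcs N \<Longrightarrow> a \<notin> S \<Longrightarrow> \<mu>' (arc_pt a) = 0" and a: "a \<in> arcs N" "a \<notin> S"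
  have "arc_rev a \<notin> S" using rev[of "arc_rev a"] a by auto
  then have "\<mu> (arc_pt a) + \<mu> (arc_pt (arc_rev a)) = 0"
    using pair[OF a(1)] z a by simp
  then show "\<mu> (arc_pt a) = 0" using nn[of "arc_pt a"] nn[of "arc_pt (arc_rev a)"] by linarith
qed

lemma same_point_E:
  fixes \<mu> \<mu>' :: "(coord \<Rightarrow> real) \<Rightarrow> real"
  assumes eq: "\<And>c. (\<Sum>x\<in>Pi_set N. \<mu> x * x c) = (\<Sum>x\<in>Pi_set N. \<mu>' x * x c)"
    and nn: "\<And>x. 0 \<le> \<mu> x" and S: "S \<subseteq> arcs N" and rev: "\<And>a. a \<in> S \<Longrightarrow> arc_rev a \<in> S"
    and z: "\<And>a. a \<in> arcs N \<Longrightarrow> a \<notin> S \<Longrightarrow> \<mu>' (arc_pt a) = 0"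
  shows "(\<Sum>a\<in>S. if fst a = k then \<mu> (arc_pt a) else 0) = (\<Sum>a\<in>S. if fst a = k then \<mu>' (arc_pt a) else 0)"
proof -
  have "\<mu> (arc_pt a) = 0" if "a \<in> arcs N" "a \<notin> S" for a
    by (rule same_point_out[OF eq nn rev z that])
  then show ?thesis
    using supported_sum_E[OF S, of \<mu> k] supported_sum_E[OF S, of \<mu>' k] z eq[of "E k"] by simp
qed

lemma triangulation_inter:
  assumes "triangulation A T" "\<sigma> \<in> T" "\<sigma>' \<in> T"
  obtains G where "is_face \<sigma> G" "is_face \<sigma>' G" "conv \<sigma> \<inter> conv \<sigma>' = conv G"
proof -
  have "\<forall>\<sigma>\<in>T. \<forall>\<sigma>'\<in>T. \<exists>G. is_face \<sigma> G \<and> is_face \<sigma>' G \<and> conv \<sigma> \<inter> conv \<sigma>' = conv G"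
    using assms(1) by (simp add: triangulation_def)
  from bspec[OF bspec[OF this assms(2)] assms(3)] show thesis using that by blast
qed

lemma tri_in_Pi:
  assumes "in_box N x" "l \<in> {1..4}"
  shows "tri_pos x l \<subseteq> Pi_set N" "tri_neg x l \<subseteq> Pi_set N"
  using assms unfolding tri_pos_def tri_neg_def face_adj_def in_box_def
  by (auto simp: atLeastAtMost_1_4 arcs_def intro!: edge_pt_in_Pi_set)

text \<open>Both halves have the same barycentre. They are disjoint, so their only common face is
  empty and \<open>T\<close> cannot contain both; and a simplex of \<open>T\<close> that covers the
  barycentre must contain one of them.\<close>

lemma triangle_dichotomy:
  assumes T: "triangulation (Pi_set N) T" and d: "i \<noteq> j" "j \<noteq> k" "k \<noteq> i"
    and arcs: "(i, j, r) \<in> arcs N" "(j, k, s) \<in> arcs N" "(k, i, t) \<in> arcs N"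
  shows "{edge_pt i j r, edge_pt j k s, edge_pt k i t} \<in> T \<or> {edge_pt j i (- r), edge_pt k j (- s), edge_pt i k (- t)} \<in> T" (is "?A \<in> T \<or> ?B \<in> T")
    and "\<not> ({edge_pt i j r, edge_pt j k s, edge_pt k i t} \<in> T \<and> {edge_pt j i (- r), edge_pt k j (- s), edge_pt i k (- t)} \<in> T)"
proof -
  define A where "A = {(i, j, r), (j, k, s), (k, i, t)}"
  define B where "B = {(j, i, - r), (k, j, - s), (i, k, - t)}"
  have AB: "A \<subseteq> arcs N" "B \<subseteq> arcs N" using arcs by (auto simp: A_def B_def arcs_def)
  have disj: "A \<inter> B = {}" using d by (auto simp: A_def B_def)
  have card: "card A = 3" "card B = 3" using d by (auto simp: A_def B_def)
  have rev: "arc_rev a \<in> A \<longleftrightarrow> a \<in> B" "arc_rev a \<in> B \<longleftrightarrow> a \<in> A" for a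
    by (cases a; auto simp: A_def B_def)+
  have img: "?A = arc_pt ` A" "?B = arc_pt ` B" by (simp_all add: A_def B_def)
  define w where "w = (\<lambda>C y. if y \<in> arc_pt ` C then 1 / 3 else 0 :: real)"
  have w: "w C (arc_pt a) = (if a \<in> C then 1/3 else 0)" if "a \<in> arcs N" "C \<subseteq> arcs N" for a C
    using that inj_arc_pt[of N] unfolding w_def by (auto dest: inj_onD)
  have wi: "w C (arc_pt a) = 1/3" if "a \<in> C" for a C
    using that by (simp add: w_def)
  define p where "p = (\<lambda>c. \<Sum>y\<in>Pi_set N. w A y * y c)"
  have fst_sum: "(\<Sum>a\<in>A. if fst a = u then f else 0) = (\<Sum>a\<in>B. if fst a = u then f else 0)" for u and f :: real
    using d by (auto simp: A_def B_def)
  have sE: "(\<Sum>y\<in>Pi_set N. w C y * y (E u)) = (\<Sum>a\<in>C. if fst a = u then 1/3 else 0)" if "C \<subseteq> arcs N" for C u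
    using that by (subst supported_sum_E[OF that]) (auto simp: w wi simp del: arc_pt_simp intro!: sum.cong)
  have pB: "p c = (\<Sum>y\<in>Pi_set N. w B y * y c)" for c
    unfolding p_def
  proof (rule sum_Pi_set_eqI)
    fix u
    show "(\<Sum>a | a \<in> arcs N \<and> fst a = u. w A (arc_pt a)) = (\<Sum>a | a \<in> arcs N \<and> fst a = u. w B (arc_pt a))"
      unfolding sum_Pi_set_E[symmetric] using AB by (simp add: sE fst_sum)
  next
    fix u v q assume a: "(u, v, q) \<in> arcs N"
    then have a': "(v, u, - q) \<in> arcs N" by (auto simp: arcs_def)
    show "w A (edge_pt u v q) + w A (edge_pt v u (- q)) = w B (edge_pt u v q) + w B (edge_pt v u (- q))"
      using w[OF a AB(1)] w[OF a' AB(1)] w[OF a AB(2)] w[OF a' AB(2)] rev[of "(u, v, q)"] rev[of "(v, u, - q)"]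
      by simp
  qed
  have conv: "p \<in> conv (arc_pt ` C)" if C: "C \<subseteq> arcs N" "card C = 3" "\<And>c. p c = (\<Sum>y\<in>Pi_set N. w C y * y c)" for C
  proof (rule conv_subset_PiI[of _ _ "w C"])
    have "(\<Sum>y\<in>Pi_set N. w C y) = (\<Sum>a\<in>C. 1/3)"
      unfolding sum_Pi_set using C(1) by (intro sum.mono_neutral_cong_right) (auto simp: w wi simp del: arc_pt_simp)
    then show "(\<Sum>y\<in>Pi_set N. w C y) = 1" using C by simp
    show "arc_pt ` C \<subseteq> Pi_set N" using C by (auto simp: Pi_set_eq)
  qed (use C(3) in \<open>auto simp: w_def\<close>)
  have pA': "p \<in> conv ?A" and pB': "p \<in> conv ?B"
    unfolding img using conv[OF AB(1) card(1)] conv[OF AB(2) card(2) pB] by (auto simp: p_def)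
  show "\<not> (?A \<in> T \<and> ?B \<in> T)"
  proof (rule notI, elim conjE)
    assume "?A \<in> T" "?B \<in> T"
    then obtain G where G: "is_face ?A G" "is_face ?B G" "conv ?A \<inter> conv ?B = conv G"
      by (rule triangulation_inter[OF T])
    have "G \<subseteq> ?A" "G \<subseteq> ?B" using G(1,2) unfolding is_face_def by auto
    moreover have "?A \<inter> ?B = {}" unfolding img
      using inj_on_image_Int[OF inj_arc_pt AB] disj by simp
    ultimately have "G = {}" by blast
    then have "conv G = {}" by (simp add: conv_def)
    then show False using G(3) pA' pB' by blast
  qed
  have "p \<in> conv (Pi_set N)"
  proof (rule conv_subset_PiI[of _ _ "w A"])
    have "(\<Sum>y\<in>Pi_set N. w A y) = (\<Sum>a\<in>A. 1/3)"
      unfolding sum_Pi_set using AB(1) by (intro sum.mono_neutral_cong_right) (auto simp: w wi simp del: arc_pt_simp)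
    then show "(\<Sum>y\<in>Pi_set N. w A y) = 1" using card by simp
  qed (auto simp: w_def p_def)
  then obtain \<sigma> \<mu> where \<mu>: "\<sigma> \<in> T" "\<And>x. 0 \<le> \<mu> x" "\<And>x. x \<in> Pi_set N \<Longrightarrow> \<mu> x \<noteq> 0 \<Longrightarrow> x \<in> \<sigma>"
    "\<And>c. p c = (\<Sum>x\<in>Pi_set N. \<mu> x * x c)"
    using cover_obtain[OF T, of p] by blast
  have eq: "(\<Sum>x\<in>Pi_set N. \<mu> x * x c) = (\<Sum>x\<in>Pi_set N. w A x * x c)" for c
    using \<mu>(4)[of c] by (simp add: p_def)
  have pair: "\<mu> (arc_pt a) + \<mu> (arc_pt (arc_rev a)) = 1/3" if "a \<in> A" for a
  proof -
    have "a \<in> arcs N" "arc_rev a \<notin> A" using that AB disj rev by auto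
    then show ?thesis using same_point_pair[OF eq, of a] that by (simp add: w AB)
  qed
  have e: "(\<Sum>a\<in>A \<union> B. if fst a = u then \<mu> (arc_pt a) else 0)
      = (\<Sum>a\<in>A \<union> B. if fst a = u then w A (arc_pt a) else 0)" for u
    by (rule same_point_E[OF eq \<mu>(2)]) (use AB rev w in auto)
  have wA: "w A (edge_pt i j r) = 1/3" "w A (edge_pt j k s) = 1/3" "w A (edge_pt k i t) = 1/3"
    "w A (edge_pt j i (- r)) = 0" "w A (edge_pt k j (- s)) = 0" "w A (edge_pt i k (- t)) = 0"
    using w[of "(i, j, r)" A] w[of "(j, k, s)" A] w[of "(k, i, t)" A]
      w[of "(j, i, - r)" A] w[of "(k, j, - s)" A] w[of "(i, k, - t)" A] AB d
    by (simp_all add: A_def B_def)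
  have union: "A \<union> B = {(i, j, r), (j, k, s), (k, i, t), (j, i, - r), (k, j, - s), (i, k, - t)}"
    by (auto simp: A_def B_def)
  \<comment> \<open>Outgoing sums and pair sums make \<open>\<mu>\<close> constant on
    \<open>A\<close>, say c, and 1/3 - c on \<open>B\<close>; these are not both 0.\<close>
  have "\<mu> (edge_pt i j r) + \<mu> (edge_pt i k (- t)) = 1/3" "\<mu> (edge_pt j k s) + \<mu> (edge_pt j i (- r)) = 1/3"
    using e[of i] e[of j] d unfolding union by (simp_all add: wA)
  moreover have "\<mu> (edge_pt i j r) + \<mu> (edge_pt j i (- r)) = 1/3" "\<mu> (edge_pt j k s) + \<mu> (edge_pt k j (- s)) = 1/3"
    "\<mu> (edge_pt k i t) + \<mu> (edge_pt i k (- t)) = 1/3"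
    using pair[of "(i, j, r)"] pair[of "(j, k, s)"] pair[of "(k, i, t)"] by (simp_all add: A_def)
  ultimately have "(\<mu> (edge_pt i j r) \<noteq> 0 \<and> \<mu> (edge_pt j k s) \<noteq> 0 \<and> \<mu> (edge_pt k i t) \<noteq> 0) \<or>
     (\<mu> (edge_pt j i (- r)) \<noteq> 0 \<and> \<mu> (edge_pt k j (- s)) \<noteq> 0 \<and> \<mu> (edge_pt i k (- t)) \<noteq> 0)"
    by linarith
  moreover have "?A \<subseteq> Pi_set N" "?B \<subseteq> Pi_set N" unfolding img using AB by (auto simp: Pi_set_eq)
  ultimately have "?A \<subseteq> \<sigma> \<or> ?B \<subseteq> \<sigma>" using \<mu>(3) by auto
  then show "?A \<in> T \<or> ?B \<in> T" using triangulation_subset[OF T \<mu>(1)] by blast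
qed

lemma tri_dichotomy:
  assumes T: "triangulation (Pi_set N) T" and "in_box N x" "l \<in> {1..4}"
  shows "tri_pos x l \<in> T \<or> tri_neg x l \<in> T" "\<not> (tri_pos x l \<in> T \<and> tri_neg x l \<in> T)"
proof -
  obtain i j k where f: "face_adj l = (i, j, k)" by (cases "face_adj l")
  then have d: "i \<in> {1..4}" "j \<in> {1..4}" "k \<in> {1..4}" "i \<noteq> j" "j \<noteq> k" "k \<noteq> i"
    using assms(3) by (auto simp: face_adj_def split: if_splits)
  then have a: "(i, j, x i - x j) \<in> arcs N" "(j, k, x j - x k) \<in> arcs N" "(k, i, x k - x i) \<in> arcs N"
    using assms(2) by (auto simp: in_box_def arcs_def)
  show "tri_pos x l \<in> T \<or> tri_neg x l \<in> T" "\<not> (tri_pos x l \<in> T \<and> tri_neg x l \<in> T)"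
    using triangle_dichotomy[OF T d(4-6) a] by (simp_all add: tri_pos_def tri_neg_def f)
qed

lemma tetrahedron_not_all_equal:
  assumes T: "triangulation (Pi_set N) T" and box: "in_box N x"
  shows "\<exists>l\<in>{1..4}. tri_pos x l \<in> T" "\<exists>l\<in>{1..4}. tri_neg x l \<in> T"
proof -
  define S where "S = {(i, j, r). i \<in> {1..4} \<and> j \<in> {1..4} \<and> i \<noteq> j \<and> r = x i - x j}"
  have S: "S \<subseteq> arcs N" using box by (auto simp: S_def arcs_def in_box_def)
  have cardS: "card S = 12"
  proof -
    have "S = (\<lambda>(i, j). (i, j, x i - x j)) ` (SIGMA i:{1..4}. {1..4} - {i})"
      by (auto simp: S_def image_iff)
    moreover have "inj_on (\<lambda>(i, j). (i, j, x i - x j)) (SIGMA i:{1..4}. {1..4} - {i})"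
      by (auto simp: inj_on_def)
    ultimately show ?thesis by (simp add: card_image card_SigmaI)
  qed
  have finS: "finite S" using S finite_arcs by (rule finite_subset)
  define \<mu>0 where "\<mu>0 = (\<lambda>y. if y \<in> arc_pt ` S then 1 / 12 else 0 :: real)"
  define p where "p = (\<lambda>c. \<Sum>y\<in>Pi_set N. \<mu>0 y * y c)"
  have \<mu>0: "\<mu>0 (arc_pt a) = (if a \<in> S then 1/12 else 0)" if "a \<in> arcs N" for a
    using that S inj_arc_pt[of N] unfolding \<mu>0_def by (auto dest: inj_onD)
  have "p \<in> conv (Pi_set N)"
  proof (rule conv_subset_PiI[of _ _ \<mu>0])
    have "(\<Sum>y\<in>Pi_set N. \<mu>0 y) = (\<Sum>a\<in>S. 1/12)"
      unfolding sum_Pi_set using S \<mu>0 by (intro sum.mono_neutral_cong_right) (auto simp del: arc_pt_simp)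
    then show "(\<Sum>y\<in>Pi_set N. \<mu>0 y) = 1" using cardS by simp
  qed (auto simp: p_def \<mu>0_def)
  then obtain \<sigma> \<mu> where \<mu>: "\<sigma> \<in> T" "\<And>x. 0 \<le> \<mu> x" "\<And>x. x \<in> Pi_set N \<Longrightarrow> \<mu> x \<noteq> 0 \<Longrightarrow> x \<in> \<sigma>"
    "\<And>c. p c = (\<Sum>x\<in>Pi_set N. \<mu> x * x c)"
    using cover_obtain[OF T, of p] by blast
  have eq: "(\<Sum>x\<in>Pi_set N. \<mu> x * x c) = (\<Sum>x\<in>Pi_set N. \<mu>0 x * x c)" for c
    using \<mu>(4)[of c] by (simp add: p_def)
  have rev: "arc_rev a \<in> S" if "a \<in> S" for a using that by (auto simp: S_def)
  have pF: "\<mu> (edge_pt u v r) + \<mu> (edge_pt v u (- r)) = \<mu>0 (edge_pt u v r) + \<mu>0 (edge_pt v u (- r))" if "(u, v, r) \<in> arcs N" for u v r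
    using same_point_pair[OF eq that] by simp
  have e: "(\<Sum>a\<in>S. if fst a = u then \<mu> (arc_pt a) else 0) = (\<Sum>a\<in>S. if fst a = u then \<mu>0 (arc_pt a) else 0)" for u
    by (rule same_point_E[OF eq \<mu>(2) S rev]) (use \<mu>0 in auto)
  define m where "m = (\<lambda>i j. \<mu> (edge_pt i j (x i - x j)))"
  have m0: "m i j \<ge> 0" for i j by (simp add: m_def \<mu>)
  have eS: "(\<Sum>a\<in>S. if fst a = u then f a else 0) = (\<Sum>v\<in>{1..4} - {u}. f (u, v, x u - x v))"
    if "u \<in> {1..4}" for u and f :: "_ \<Rightarrow> real"
  proof -
    have "(\<Sum>a\<in>S. if fst a = u then f a else 0) = (\<Sum>a | a \<in> S \<and> fst a = u. f a)"
      using finS by (simp add: sum.inter_filter)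
    also have "\<dots> = (\<Sum>v\<in>{1..4} - {u}. f (u, v, x u - x v))"
      using that by (intro sum.reindex_cong[of "\<lambda>v. (u, v, x u - x v)"]) (auto simp: inj_on_def S_def)
    finally show ?thesis .
  qed
  have in_S: "(u, v, x u - x v) \<in> S" if "u \<in> {1..4}" "v \<in> {1..4}" "u \<noteq> v" for u v
    using that by (simp add: S_def)
  have me: "(\<Sum>v\<in>{1..4} - {u}. m u v) = 1/4" if u: "u \<in> {1..4}" for u
  proof -
    have "(\<Sum>v\<in>{1..4} - {u}. m u v) = (\<Sum>v\<in>{1..4} - {u}. \<mu>0 (arc_pt (u, v, x u - x v)))"
      using e[of u] eS[OF u] by (simp add: m_def)
    also have "\<dots> = (\<Sum>v\<in>{1..4} - {u}. 1/12)"
      using in_S S u by (intro sum.cong refl) (subst \<mu>0, auto)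
    finally show ?thesis using u by simp
  qed
  have mf: "m u v + m v u = 1/6" if "u \<in> {1..4}" "v \<in> {1..4}" "u \<noteq> v" for u v
  proof -
    have "(u, v, x u - x v) \<in> S" "(v, u, x v - x u) \<in> S" using in_S that by auto
    moreover from this have "(u, v, x u - x v) \<in> arcs N" "(v, u, x v - x u) \<in> arcs N" using S by blast+
    ultimately show ?thesis
      using pF[of u v "x u - x v"] \<mu>0[of "(u, v, x u - x v)"] \<mu>0[of "(v, u, x v - x u)"]
      by (simp add: m_def)
  qed
  have eqs: "m 1 2 + m 1 3 + m 1 4 = 1/4" "m 2 1 + m 2 3 + m 2 4 = 1/4" "m 3 1 + m 3 2 + m 3 4 = 1/4"
    "m 4 1 + m 4 2 + m 4 3 = 1/4"
    using me[of 1] me[of 2] me[of 3] me[of 4] unfolding atLeastAtMost_1_4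
    by (simp_all add: insert_Diff_if)
  have fs: "m 1 2 + m 2 1 = 1/6" "m 1 3 + m 3 1 = 1/6" "m 1 4 + m 4 1 = 1/6" "m 2 3 + m 3 2 = 1/6"
    "m 2 4 + m 4 2 = 1/6" "m 3 4 + m 4 3 = 1/6"
    by (simp_all add: mf)
  have memT: "tri_pos x l \<in> T" if l: "l \<in> {1..4}" and "face_adj l = (i, j, k)" "m i j \<noteq> 0" "m j k \<noteq> 0" "m k i \<noteq> 0" for l i j k
  proof (rule triangulation_subset[OF T \<mu>(1)])
    show "tri_pos x l \<subseteq> \<sigma>" using that(2-) tri_in_Pi[OF box l] \<mu>(3)
      by (auto simp: tri_pos_def m_def)
  qed
  have memT': "tri_neg x l \<in> T" if l: "l \<in> {1..4}" and "face_adj l = (i, j, k)" "m j i \<noteq> 0" "m k j \<noteq> 0" "m i k \<noteq> 0" for l i j k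
  proof (rule triangulation_subset[OF T \<mu>(1)])
    show "tri_neg x l \<subseteq> \<sigma>" using that(2-) tri_in_Pi[OF box l] \<mu>(3)
      by (auto simp: tri_neg_def m_def)
  qed
  \<comment> \<open>\<open>m\<close> minus 1/12 is a circulation with values between -1/12 and 1/12.
    If each facet had an arc of weight 0, four different edges would be saturated. Three saturated
    edges cannot meet at a vertex, as three terms of equal size do not sum to 0, so the four form a
    4-cycle; it is directed, since two saturated arcs leaving a vertex would overload the third. But
    a directed 4-cycle has two arcs in each of two facets and none in the others. The same argument
    serves the opposite orientation.\<close>
  have "(m 3 2 \<noteq> 0 \<and> m 2 4 \<noteq> 0 \<and> m 4 3 \<noteq> 0) \<or> (m 1 3 \<noteq> 0 \<and> m 3 4 \<noteq> 0 \<and> m 4 1 \<noteq> 0) \<or>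
    (m 2 1 \<noteq> 0 \<and> m 1 4 \<noteq> 0 \<and> m 4 2 \<noteq> 0) \<or> (m 1 2 \<noteq> 0 \<and> m 2 3 \<noteq> 0 \<and> m 3 1 \<noteq> 0)"
    using eqs fs m0[of 1 2] m0[of 2 1] m0[of 1 3] m0[of 3 1] m0[of 1 4] m0[of 4 1] m0[of 2 3] m0[of 3 2]
      m0[of 2 4] m0[of 4 2] m0[of 3 4] m0[of 4 3] by linarith
  then show "\<exists>l\<in>{1..4}. tri_pos x l \<in> T"
    using memT[of 1 3 2 4] memT[of 2 1 3 4] memT[of 3 2 1 4] memT[of 4 1 2 3] by (auto simp: face_adj_def)
  have "(m 2 3 \<noteq> 0 \<and> m 4 2 \<noteq> 0 \<and> m 3 4 \<noteq> 0) \<or> (m 3 1 \<noteq> 0 \<and> m 4 3 \<noteq> 0 \<and> m 1 4 \<noteq> 0) \<or>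
    (m 1 2 \<noteq> 0 \<and> m 4 1 \<noteq> 0 \<and> m 2 4 \<noteq> 0) \<or> (m 2 1 \<noteq> 0 \<and> m 3 2 \<noteq> 0 \<and> m 1 3 \<noteq> 0)"
    using eqs fs m0[of 1 2] m0[of 2 1] m0[of 1 3] m0[of 3 1] m0[of 1 4] m0[of 4 1] m0[of 2 3] m0[of 3 2]
      m0[of 2 4] m0[of 4 2] m0[of 3 4] m0[of 4 3] by linarith
  then show "\<exists>l\<in>{1..4}. tri_neg x l \<in> T"
    using memT'[of 1 3 2 4] memT'[of 2 1 3 4] memT'[of 3 2 1 4] memT'[of 4 1 2 3] by (auto simp: face_adj_def)
qed

lemma index_cases: "l \<in> {1..4} \<longleftrightarrow> l = 1 \<or> l = 2 \<or> l = 3 \<or> l = (4::nat)"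
  by auto

section \<open>Flips\<close>

text \<open>A join of the link with a subset of the circuit missing a point of \<open>Xm\<close> is
  put back, so what is lost contains \<open>Xm\<close>. A join missing a point x of
  \<open>Xp\<close> lies in the join with the maximal set that omits just x, which was in
  \<open>T\<close> already, so what is new contains \<open>Xp\<close>.\<close>

lemma flip_step_diff:
  assumes T: "triangulation (Pi_set N) T" and flip: "flip_step (Pi_set N) T T'"
  obtains Xp Xm where "aff_dependent (Xp \<union> Xm)" "\<And>Y. Y \<in> T \<Longrightarrow> Y \<notin> T' \<Longrightarrow> Xm \<subseteq> Y"
    "\<And>Y. Y \<in> T' \<Longrightarrow> Y \<notin> T \<Longrightarrow> Xp \<subseteq> Y"
proof -
  obtain Xp Xm L where circ: "signed_circuit (Pi_set N) Xp Xm"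
    and max: "\<forall>\<sigma>\<in>circ_tri (Xp \<union> Xm) Xp.
        (\<forall>\<tau>\<in>circ_tri (Xp \<union> Xm) Xp. \<sigma> \<subseteq> \<tau> \<longrightarrow> \<tau> = \<sigma>) \<longrightarrow> link T \<sigma> = L"
    and T': "T' = (T - {\<rho> \<union> \<sigma> | \<rho> \<sigma>. \<rho> \<in> L \<and> \<sigma> \<in> circ_tri (Xp \<union> Xm) Xp})
          \<union> {\<rho> \<union> \<sigma> | \<rho> \<sigma>. \<rho> \<in> L \<and> \<sigma> \<in> circ_tri (Xp \<union> Xm) Xm}"
    using flip unfolding flip_step_def by (elim exE conjE) (rule that)
  have mem: "Y \<in> T' \<longleftrightarrow> Y \<in> T \<and> \<not> (\<exists>\<rho> \<sigma>. Y = \<rho> \<union> \<sigma> \<and> \<rho> \<in> L \<and> \<sigma> \<in> circ_tri (Xp \<union> Xm) Xp)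
      \<or> (\<exists>\<rho> \<sigma>. Y = \<rho> \<union> \<sigma> \<and> \<rho> \<in> L \<and> \<sigma> \<in> circ_tri (Xp \<union> Xm) Xm)" for Y
    unfolding T' by simp
  show thesis
  proof (rule that)
    show "aff_dependent (Xp \<union> Xm)" using circ by (simp add: signed_circuit_def is_circuit_def)
    show "Xm \<subseteq> Y" if "Y \<in> T" "Y \<notin> T'" for Y
    proof -
      have "\<exists>\<rho> \<sigma>. Y = \<rho> \<union> \<sigma> \<and> \<rho> \<in> L \<and> \<sigma> \<in> circ_tri (Xp \<union> Xm) Xp"
        and not: "\<not> (\<exists>\<rho> \<sigma>. Y = \<rho> \<union> \<sigma> \<and> \<rho> \<in> L \<and> \<sigma> \<in> circ_tri (Xp \<union> Xm) Xm)"
        using mem[of Y] that by argo+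
      then obtain \<rho> \<sigma> where Y: "Y = \<rho> \<union> \<sigma>" "\<rho> \<in> L" "\<sigma> \<in> circ_tri (Xp \<union> Xm) Xp"
        by (elim exE conjE) (rule that)
      have "\<sigma> \<notin> circ_tri (Xp \<union> Xm) Xm"
      proof
        assume "\<sigma> \<in> circ_tri (Xp \<union> Xm) Xm"
        then show False using not Y(1,2) by (auto simp del: ex_simps)
      qed
      then show ?thesis using Y by (auto simp: circ_tri_def)
    qed
    show "Xp \<subseteq> Y" if "Y \<in> T'" "Y \<notin> T" for Y
    proof (rule ccontr)
      assume nsub: "\<not> Xp \<subseteq> Y"
      have "\<exists>\<rho> \<sigma>. Y = \<rho> \<union> \<sigma> \<and> \<rho> \<in> L \<and> \<sigma> \<in> circ_tri (Xp \<union> Xm) Xm"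
        using mem[of Y] that by argo
      then obtain \<rho> \<sigma> where Y: "Y = \<rho> \<union> \<sigma>" "\<rho> \<in> L" "\<sigma> \<in> circ_tri (Xp \<union> Xm) Xm"
        by (elim exE conjE) (rule that)
      obtain x where x: "x \<in> Xp" "x \<notin> \<sigma>" using nsub Y(1) by blast
      define \<tau> where "\<tau> = (Xp \<union> Xm) - {x}"
      have "\<tau> \<in> circ_tri (Xp \<union> Xm) Xp" using x by (auto simp: \<tau>_def circ_tri_def)
      moreover have "\<forall>\<tau>'\<in>circ_tri (Xp \<union> Xm) Xp. \<tau> \<subseteq> \<tau>' \<longrightarrow> \<tau>' = \<tau>"
        unfolding \<tau>_def circ_tri_def by blast
      ultimately have "link T \<tau> = L" using max by simp
      then have "\<tau> \<union> \<rho> \<in> T" using Y(2) by (auto simp: link_def)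
      moreover have "Y \<subseteq> \<tau> \<union> \<rho>" using Y(1,3) x by (auto simp: \<tau>_def circ_tri_def)
      ultimately have "Y \<in> T" by (rule triangulation_subset[OF T])
      with that show False by simp
    qed
  qed
qed

lemma edge_independent:
  assumes "i \<noteq> j" "X \<subseteq> {edge_pt i j r, edge_pt j i (- r)}"
  shows "\<not> aff_dependent X"
proof
  assume "aff_dependent X"
  then obtain Z \<mu> y where Z: "Z \<subseteq> X" "\<And>c. (\<Sum>x\<in>Z. \<mu> x * x c) = 0" "y \<in> Z" "\<mu> y \<noteq> 0"
    unfolding aff_dependent_def by blast
  then have sub: "Z \<subseteq> {edge_pt i j r, edge_pt j i (- r)}" using assms by blast
  have "(\<Sum>x\<in>Z. \<mu> x * x c) = (\<Sum>x\<in>{edge_pt i j r, edge_pt j i (- r)}. if x \<in> Z then \<mu> x * x c else 0)" for c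
    using sub by (intro sum.mono_neutral_cong_left) auto
  then have "(\<Sum>x\<in>{edge_pt i j r, edge_pt j i (- r)}. if x \<in> Z then \<mu> x * x c else 0) = 0" for c
    using Z(2) by simp
  from this[of "E i"] this[of "E j"] show False
    using assms(1) Z(3,4) sub by (auto simp: edge_pt_inject split: if_splits)
qed

definition oriented_tri :: "int \<Rightarrow> (nat \<Rightarrow> int) \<Rightarrow> nat \<Rightarrow> (coord \<Rightarrow> real) set" where
  "oriented_tri s x l = (if s = 1 then tri_pos x l else tri_neg x l)"

lemma oriented_tri_iff:
  assumes "triangulation (Pi_set N) T" "in_box N x" "l \<in> {1..4}" "s = 1 \<or> s = -1"
  shows "oriented_tri (- s) x l \<in> T \<longleftrightarrow> oriented_tri s x l \<notin> T"
  using tri_dichotomy[OF assms(1-3)] assms(4) by (auto simp: oriented_tri_def)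

lemma oriented_tri_exists:
  assumes "triangulation (Pi_set N) T" "in_box N x"
  shows "\<exists>l\<in>{1..4}. oriented_tri s x l \<in> T"
  using tetrahedron_not_all_equal[OF assms] by (cases "s = 1") (simp_all add: oriented_tri_def)

lemma oriented_tri_update: "l \<in> {1..4} \<Longrightarrow> oriented_tri s (x(l := t)) l = oriented_tri s x l"
  unfolding index_cases by (auto simp: oriented_tri_def tri_pos_def tri_neg_def face_adj_def)

text \<open>Two facets share one edge and traverse it in opposite directions, so halves of opposite
  sign have at most one arc of this edge in common.\<close>

lemma oriented_tri_inter:
  assumes "l \<in> {1..4}" "l' \<in> {1..4}" "l \<noteq> l'" "s = 1 \<or> s = -1"
  obtains i j r where "i \<noteq> j" "oriented_tri (- s) x l \<inter> oriented_tri s x l' \<subseteq> {edge_pt i j r}"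
    "oriented_tri s x l \<inter> oriented_tri (- s) x l' \<subseteq> {edge_pt j i (- r)}"
proof -
  define C where "C = (\<lambda>i j l l'. i \<noteq> j \<and> tri_neg x l \<inter> tri_pos x l' \<subseteq> {edge_pt i j (x i - x j)} \<and>
    tri_pos x l \<inter> tri_neg x l' \<subseteq> {edge_pt j i (x j - x i)})"
  have swap: "C i j l l' \<longleftrightarrow> C j i l' l" for i j l l' by (auto simp: C_def Int_commute)
  have "C 3 4 1 2" "C 4 2 1 3" "C 2 3 1 4" "C 1 4 2 3" "C 3 1 2 4" "C 1 2 3 4"
    by (auto simp: C_def tri_pos_def tri_neg_def face_adj_def edge_pt_inject)
  moreover from this have "C 4 3 2 1" "C 2 4 3 1" "C 3 2 4 1" "C 4 1 3 2" "C 1 3 4 2" "C 2 1 4 3"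
    by (simp_all add: swap)
  ultimately have "\<exists>i j. C i j l l'"
    using assms(1-3) unfolding index_cases by (elim disjE) auto
  then obtain i j where "C i j l l'" by blast
  then show thesis
    using assms(4) that[of i j "x i - x j"] that[of j i "x j - x i"] by (auto simp: C_def oriented_tri_def)
qed

section \<open>Signs that block every flip\<close>

text \<open>The argument \<open>m\<close> is half the period: 1, 2 and 4 give the periods 2, 4 and
  8.\<close>

definition square_wave :: "int \<Rightarrow> int \<Rightarrow> int" where
  "square_wave m d = (if d mod (2 * m) < m then 1 else -1)"

text \<open>Modulo the factor b and the sign for l = 1, the sign of line l is the coboundary of the square
  waves on the edges of the facet opposite to l, so every edge contributes to two lines and the
  product of the four signs is -1. The periods at each vertex of the tetrahedron are 2, 4 and 8,
  hence all sign patterns of the three edges at l occur on every eight consecutive integers.\<close>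

definition line_sign :: "int \<Rightarrow> (nat \<Rightarrow> int) \<Rightarrow> nat \<Rightarrow> int" where
  "line_sign b x l = b *
    (if l = 1 then - square_wave 4 (x 2 - x 3) * square_wave 2 (x 2 - x 4) * square_wave 1 (x 3 - x 4)
     else if l = 2 then square_wave 2 (x 1 - x 3) * square_wave 4 (x 1 - x 4) * square_wave 1 (x 3 - x 4)
     else if l = 3 then square_wave 1 (x 1 - x 2) * square_wave 4 (x 1 - x 4) * square_wave 2 (x 2 - x 4)
     else square_wave 1 (x 1 - x 2) * square_wave 2 (x 1 - x 3) * square_wave 4 (x 2 - x 3))"

lemma square_wave_cases: "square_wave m d = 1 \<or> square_wave m d = -1"
  by (simp add: square_wave_def)

lemma square_wave_square [simp]: "square_wave m d * square_wave m d = 1" "square_wave m d * (square_wave m d * z) = z"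
  using square_wave_cases[of m d] by auto

lemma abs_square_wave [simp]: "\<bar>square_wave m d\<bar> = 1"
  by (simp add: square_wave_def)

lemma line_sign_cases: "b = 1 \<or> b = -1 \<Longrightarrow> line_sign b x l = 1 \<or> line_sign b x l = -1"
proof -
  assume "b = 1 \<or> b = -1"
  then have "\<bar>b\<bar> = 1" by auto
  then have "\<bar>line_sign b x l\<bar> = 1" by (simp add: line_sign_def abs_mult)
  then show ?thesis by linarith
qed

lemma line_sign_minus: "line_sign (- b) x l = - line_sign b x l"
  by (simp add: line_sign_def)

lemma line_sign_update: "l \<in> {1..4} \<Longrightarrow> line_sign b (x(l := t)) l = line_sign b x l"
  unfolding index_cases by (auto simp: line_sign_def)

text \<open>The wave is not odd: it is the reflection d to -1 - d that reverses the residues 0, ...,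
  2m - 1 and swaps the two halves of a period. Hence the shift by one.\<close>

lemma square_wave_uminus:
  assumes "m > 0"
  shows "square_wave m (- d) = - square_wave m (d - 1)"
proof -
  have bounds: "0 \<le> (d - 1) mod (2 * m)" "(d - 1) mod (2 * m) < 2 * m"
    using assms by simp_all
  have "(- d) mod (2 * m) = 2 * m - 1 - (d - 1) mod (2 * m)"
  proof (rule int_mod_pos_eq)
    show "- d = 2 * m * (- ((d - 1) div (2 * m)) - 1) + (2 * m - 1 - (d - 1) mod (2 * m))"
      using mult_div_mod_eq[of "2 * m" "d - 1"] by (simp add: algebra_simps)
  qed (use bounds in auto)
  then show ?thesis by (auto simp: square_wave_def)
qed

lemma square_wave_shift:
  assumes "m > 0"
  shows "square_wave m (d - m) = - square_wave m d"
proof -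
  define r where "r = d mod (2 * m)"
  define q where "q = d div (2 * m)"
  have d: "d = 2 * m * q + r" unfolding q_def r_def by simp
  have r: "0 \<le> r" "r < 2 * m" using assms by (simp_all add: r_def)
  show ?thesis
  proof (cases "r < m")
    case True
    have "(d - m) mod (2 * m) = r + m"
    proof (rule int_mod_pos_eq)
      show "d - m = 2 * m * (q - 1) + (r + m)" using d by (simp add: algebra_simps)
    qed (use r True in auto)
    then show ?thesis using True r by (simp add: square_wave_def r_def[symmetric])
  next
    case False
    have "(d - m) mod (2 * m) = r - m"
    proof (rule int_mod_pos_eq)
      show "d - m = 2 * m * q + (r - m)" using d by (simp add: algebra_simps)
    qed (use r False in auto)
    then show ?thesis using False r by (simp add: square_wave_def r_def[symmetric])
  qed
qed

lemma square_wave_pattern: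
  assumes "s1 = 1 \<or> s1 = -1" "s2 = 1 \<or> s2 = -1" "s3 = 1 \<or> s3 = -1"
  shows "\<exists>t\<in>{t0..t0+7}. square_wave 1 (t - a) = s1 \<and> square_wave 2 (t - b) = s2 \<and> square_wave 4 (t - c) = s3"
proof -
  \<comment> \<open>A wanted value -1 becomes a wanted 1 when the origin of the wave is moved by
    half a period.\<close>
  define a' where "a' = (if s1 = 1 then a else a + 1)"
  define b' where "b' = (if s2 = 1 then b else b + 2)"
  define c' where "c' = (if s3 = 1 then c else c + 4)"
  \<comment> \<open>Offsets are measured from \<open>c'\<close>. All of 0, ..., 3 suit the longest
    wave; two cyclically consecutive ones suit the wave of period 4, and one of these two has the
    parity that the shortest wave wants.\<close>
  define \<alpha> where "\<alpha> = (a' - c') mod 2"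
  define \<beta> where "\<beta> = (b' - c') mod 4"
  have "\<alpha> = 0 \<or> \<alpha> = 1" "\<beta> = 0 \<or> \<beta> = 1 \<or> \<beta> = 2 \<or> \<beta> = 3"
    using pos_mod_bound[of 2 "a' - c'"] pos_mod_sign[of 2 "a' - c'"]
      pos_mod_bound[of 4 "b' - c'"] pos_mod_sign[of 4 "b' - c'"] unfolding \<alpha>_def \<beta>_def by auto
  then have "\<exists>\<tau>\<in>{0, 1, 2, 3}. (\<tau> - \<alpha>) mod 2 < 1 \<and> (\<tau> - \<beta>) mod 4 < 2"
    by (elim disjE) simp_all
  then obtain \<tau> where \<tau>: "\<tau> \<in> {0, 1, 2, 3}" "(\<tau> - \<alpha>) mod 2 < 1" "(\<tau> - \<beta>) mod 4 < 2"
    by (elim bexE conjE) (rule that)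
  define t where "t = t0 + (c' + \<tau> - t0) mod 8"
  define q where "q = (c' + \<tau> - t0) div 8"
  have t: "t \<in> {t0..t0+7}"
    using pos_mod_bound[of 8 "c' + \<tau> - t0"] pos_mod_sign[of 8 "c' + \<tau> - t0"] by (simp add: t_def)
  have tq: "t = c' + \<tau> - 8 * q"
    unfolding t_def q_def using minus_mod_eq_mult_div[of "c' + \<tau> - t0" 8] by linarith
  have "t - a' = (\<tau> - (a' - c')) + 2 * (- 4 * q)" unfolding tq by simp
  then have "(t - a') mod 2 = (\<tau> - (a' - c')) mod 2" by (simp only: mod_mult_self2)
  also have "\<dots> = (\<tau> - \<alpha>) mod 2" by (simp only: \<alpha>_def mod_diff_right_eq)
  finally have 1: "square_wave 1 (t - a') = 1" using \<tau> by (simp add: square_wave_def)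
  have "t - b' = (\<tau> - (b' - c')) + 4 * (- 2 * q)" unfolding tq by simp
  then have "(t - b') mod 4 = (\<tau> - (b' - c')) mod 4" by (simp only: mod_mult_self2)
  also have "\<dots> = (\<tau> - \<beta>) mod 4" by (simp only: \<beta>_def mod_diff_right_eq)
  finally have 2: "square_wave 2 (t - b') = 1" using \<tau> by (simp add: square_wave_def)
  have "t - c' = \<tau> + 8 * (- q)" unfolding tq by simp
  then have "(t - c') mod 8 = \<tau> mod 8" by (simp only: mod_mult_self2)
  then have 4: "square_wave 4 (t - c') = 1" using \<tau>(1) by (auto simp: square_wave_def)
  have shift: "square_wave m (t - (z + m)) = - square_wave m (t - z)" if "m > 0" for m z
    using square_wave_shift[OF that, of "t - z"] by (simp add: algebra_simps)
  have "square_wave 1 (t - a) = s1" "square_wave 2 (t - b) = s2" "square_wave 4 (t - c) = s3"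
    using assms 1 2 4 shift[of 1 a] shift[of 2 b] shift[of 4 c]
    by (auto simp: a'_def b'_def c'_def)
  then show ?thesis using t by blast
qed

text \<open>A reversed difference is treated as a direct one with its origin moved by one and the
  wanted sign negated.\<close>

lemma square_wave_pattern_rev:
  assumes "s1 = 1 \<or> s1 = -1" "s2 = 1 \<or> s2 = -1" "s3 = 1 \<or> s3 = -1"
  shows "\<exists>t\<in>{t0..t0+7}. square_wave 1 (if r1 then a - t else t - a) = s1 \<and> square_wave 2 (if r2 then b - t else t - b) = s2 \<and>
     square_wave 4 (if r3 then c - t else t - c) = s3"
proof -
  have pm: "(if r then - s else s) = 1 \<or> (if r then - s else s) = -1" if "s = 1 \<or> s = -1" for r and s :: int
    using that by auto
  obtain t where t: "t \<in> {t0..t0+7}" "square_wave 1 (t - (if r1 then a + 1 else a)) = (if r1 then - s1 else s1)"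
     "square_wave 2 (t - (if r2 then b + 1 else b)) = (if r2 then - s2 else s2)"
     "square_wave 4 (t - (if r3 then c + 1 else c)) = (if r3 then - s3 else s3)"
    using square_wave_pattern[OF pm pm pm, OF assms, of t0 "if r1 then a + 1 else a" r1 "if r2 then b + 1 else b" r2
      "if r3 then c + 1 else c" r3] by (elim bexE conjE) (rule that)
  have "square_wave m (z - t) = - square_wave m (t - (z + 1))" if "m > 0" for m z
    using square_wave_uminus[OF that, of "t - z"] by (simp add: algebra_simps)
  then show ?thesis using t by (intro bexI[of _ t]) (auto split: if_splits)
qed

lemma blocked:
  assumes N: "N \<ge> 7" and box: "in_box N x" and l: "l \<in> {1..4}"
  obtains t where "in_box N (x(l := t))" "\<And>l'. l' \<in> {1..4} \<Longrightarrow> l' \<noteq> l \<Longrightarrow> line_sign b (x(l := t)) l' = - line_sign b x l"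
proof -
  define M where "M = Max (x ` ({1..4} - {l}))"
  have ne: "x ` ({1..4} - {l}) \<noteq> {}" "finite (x ` ({1..4} - {l}))"
    using l unfolding atLeastAtMost_1_4 by auto
  have "M \<in> x ` ({1..4} - {l})" unfolding M_def using ne by (rule Max_in[rotated])
  then obtain i0 where i0: "i0 \<in> {1..4}" "i0 \<noteq> l" "M = x i0" by blast
  have le: "x i \<le> M" if "i \<in> {1..4}" "i \<noteq> l" for i
    unfolding M_def using ne that by (intro Max_ge) auto
  \<comment> \<open>M - N is the least value of coordinate \<open>l\<close> within N of the maximum
    \<open>M\<close>. The other coordinates are at least M - N, so \<open>t\<close> exceeds them by
    at most 7 \<le> N. This is the source of the bound on \<open>N\<close>.\<close>
  have box': "in_box N (x(l := t))" if t: "t \<in> {M - int N..M - int N + 7}" for t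
  proof -
    have "\<bar>t - x i\<bar> \<le> int N" if i: "i \<in> {1..4}" "i \<noteq> l" for i
    proof -
      have "M - x i \<le> int N" using box i i0 by (force simp: in_box_def)
      then show ?thesis using le[OF i] t N by auto
    qed
    then show ?thesis using box unfolding in_box_def by (auto simp: abs_minus_commute)
  qed
  have "\<exists>t\<in>{M - int N..M - int N + 7}. \<forall>l'\<in>{1..4}. l' \<noteq> l \<longrightarrow> line_sign b (x(l := t)) l' = - line_sign b x l"
  proof -
    consider "l = 1" | "l = 2" | "l = 3" | "l = 4" using l unfolding index_cases by blast
    then show ?thesis
    proof cases
      case 1
      have pm: "square_wave 1 (x 3 - x 4) = 1 \<or> square_wave 1 (x 3 - x 4) = -1" "square_wave 2 (x 2 - x 4) = 1 \<or> square_wave 2 (x 2 - x 4) = -1"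
          "square_wave 4 (x 2 - x 3) = 1 \<or> square_wave 4 (x 2 - x 3) = -1"
        by (simp_all add: square_wave_def)
      from square_wave_pattern_rev[OF pm, where ?t0.0 = "M - int N" and ?r1.0 = False and a = "x 2"
          and ?r2.0 = False and b = "x 3" and ?r3.0 = False and c = "x 4"]
      obtain t where "t \<in> {M - int N..M - int N + 7}" and t: "square_wave 1 (t - x 2) = square_wave 1 (x 3 - x 4)"
        "square_wave 2 (t - x 3) = square_wave 2 (x 2 - x 4)" "square_wave 4 (t - x 4) = square_wave 4 (x 2 - x 3)"
        by auto
      then show ?thesis
        by (intro bexI[of _ t]) (auto simp: t 1 line_sign_def index_cases mult_ac)
    next
      case 2
      have pm: "- square_wave 1 (x 3 - x 4) = 1 \<or> - square_wave 1 (x 3 - x 4) = -1" "square_wave 2 (x 1 - x 3) = 1 \<or> square_wave 2 (x 1 - x 3) = -1"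
          "square_wave 4 (x 1 - x 4) = 1 \<or> square_wave 4 (x 1 - x 4) = -1"
        by (simp_all add: square_wave_def)
      from square_wave_pattern_rev[OF pm, where ?t0.0 = "M - int N" and ?r1.0 = True and a = "x 1"
          and ?r2.0 = False and b = "x 4" and ?r3.0 = False and c = "x 3"]
      obtain t where "t \<in> {M - int N..M - int N + 7}" and t: "square_wave 1 (x 1 - t) = - square_wave 1 (x 3 - x 4)"
        "square_wave 2 (t - x 4) = square_wave 2 (x 1 - x 3)" "square_wave 4 (t - x 3) = square_wave 4 (x 1 - x 4)"
        by auto
      then show ?thesis
        by (intro bexI[of _ t]) (auto simp: t 2 line_sign_def index_cases mult_ac)
    next
      case 3
      have pm: "square_wave 1 (x 1 - x 2) = 1 \<or> square_wave 1 (x 1 - x 2) = -1" "- square_wave 2 (x 2 - x 4) = 1 \<or> - square_wave 2 (x 2 - x 4) = -1"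
          "square_wave 4 (x 1 - x 4) = 1 \<or> square_wave 4 (x 1 - x 4) = -1"
        by (simp_all add: square_wave_def)
      from square_wave_pattern_rev[OF pm, where ?t0.0 = "M - int N" and ?r1.0 = False and a = "x 4"
          and ?r2.0 = True and b = "x 1" and ?r3.0 = True and c = "x 2"]
      obtain t where "t \<in> {M - int N..M - int N + 7}" and t: "square_wave 1 (t - x 4) = square_wave 1 (x 1 - x 2)"
        "square_wave 2 (x 1 - t) = - square_wave 2 (x 2 - x 4)" "square_wave 4 (x 2 - t) = square_wave 4 (x 1 - x 4)"
        by auto
      then show ?thesis
        by (intro bexI[of _ t]) (auto simp: t 3 line_sign_def index_cases mult_ac)
    next
      case 4
      have pm: "square_wave 1 (x 1 - x 2) = 1 \<or> square_wave 1 (x 1 - x 2) = -1" "square_wave 2 (x 1 - x 3) = 1 \<or> square_wave 2 (x 1 - x 3) = -1"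
          "- square_wave 4 (x 2 - x 3) = 1 \<or> - square_wave 4 (x 2 - x 3) = -1"
        by (simp_all add: square_wave_def)
      from square_wave_pattern_rev[OF pm, where ?t0.0 = "M - int N" and ?r1.0 = True and a = "x 3"
          and ?r2.0 = True and b = "x 2" and ?r3.0 = True and c = "x 1"]
      obtain t where "t \<in> {M - int N..M - int N + 7}" and t: "square_wave 1 (x 3 - t) = square_wave 1 (x 1 - x 2)"
        "square_wave 2 (x 2 - t) = square_wave 2 (x 1 - x 3)" "square_wave 4 (x 1 - t) = - square_wave 4 (x 2 - x 3)"
        by auto
      then show ?thesis
        by (intro bexI[of _ t]) (auto simp: t 4 line_sign_def index_cases mult_ac)
    qed
  qed
  then show thesis using that box' by blast
qed

section \<open>Invariance of the signs under flips\<close>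

definition signs :: "int \<Rightarrow> nat \<Rightarrow> (coord \<Rightarrow> real) set set \<Rightarrow> bool" where
  "signs b N T \<longleftrightarrow> (\<forall>x. in_box N x \<longrightarrow> (\<forall>l\<in>{1..4}. oriented_tri (line_sign b x l) x l \<notin> T))"

text \<open>\<open>signs\<close> records the absent half of each line. At the blocked vertex
  \<open>y\<close>, \<open>T\<close> holds the half -s of line \<open>l\<close> and the half s of
  the three others. If \<open>l\<close> changed to s, some other line would have to change to -s in
  the same flip, since four equal signs are impossible; but then the whole circuit would lie on the
  common edge of two facets.\<close>

lemma signs_adj:
  assumes N: "N \<ge> 7" and b: "b = 1 \<or> b = -1" and adj: "(T, T') \<in> flip_adj (Pi_set N)" and signs: "signs b N T"
  shows "signs b N T'"
  unfolding signs_def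
proof (intro allI impI ballI notI)
  fix x l assume box: "in_box N x" and l: "l \<in> {1..4}" and bad: "oriented_tri (line_sign b x l) x l \<in> T'"
  define s where "s = line_sign b x l"
  have s: "s = 1 \<or> s = -1" unfolding s_def by (rule line_sign_cases[OF b])
  have T: "triangulation (Pi_set N) T" and T': "triangulation (Pi_set N) T'"
    using adj by (auto simp: flip_adj_def)
  obtain t where box': "in_box N (x(l := t))"
    and t: "\<And>l'. l' \<in> {1..4} \<Longrightarrow> l' \<noteq> l \<Longrightarrow> line_sign b (x(l := t)) l' = - s"
    unfolding s_def using blocked[OF N box l] by blast
  define y where "y = x(l := t)"
  have box: "in_box N y" and sign: "line_sign b y l = s" "\<And>l'. l' \<in> {1..4} \<Longrightarrow> l' \<noteq> l \<Longrightarrow> line_sign b y l' = - s"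
    using box' t line_sign_update[OF l] by (auto simp: y_def s_def)
  have 1: "oriented_tri s y l \<in> T'" using bad oriented_tri_update[OF l] by (simp add: y_def s_def)
  then have 2: "oriented_tri (- s) y l \<notin> T'" using oriented_tri_iff[OF T' box l s] by simp
  have 3: "oriented_tri s y l \<notin> T" using signs box l sign(1) unfolding signs_def by metis
  then have 4: "oriented_tri (- s) y l \<in> T" using oriented_tri_iff[OF T box l s] by simp
  obtain l' where l': "l' \<in> {1..4}" "oriented_tri (- s) y l' \<in> T'" using oriented_tri_exists[OF T' box] by blast
  then have "l' \<noteq> l" using 2 by auto
  have 5: "oriented_tri (- s) y l' \<notin> T" using signs box l'(1) sign(2)[OF l'(1) \<open>l' \<noteq> l\<close>] unfolding signs_def by metis
  have 6: "oriented_tri s y l' \<in> T" using oriented_tri_iff[OF T box l'(1) s] 5 by simp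
  have 7: "oriented_tri s y l' \<notin> T'" using oriented_tri_iff[OF T' box l'(1) s] l'(2) by simp
  obtain i j r where ij: "i \<noteq> j" "oriented_tri (- s) y l \<inter> oriented_tri s y l' \<subseteq> {edge_pt i j r}" "oriented_tri s y l \<inter> oriented_tri (- s) y l' \<subseteq> {edge_pt j i (- r)}"
    using oriented_tri_inter[OF l l'(1) \<open>l' \<noteq> l\<close>[symmetric] s] by metis
  have "flip_step (Pi_set N) T T' \<or> flip_step (Pi_set N) T' T"
    using adj by (auto simp: flip_adj_def)
  \<comment> \<open>Whichever way the flip goes, both lost halves contain one part of the circuit
    and both gained halves the other part.\<close>
  then obtain X where X: "aff_dependent X" "X \<subseteq> (oriented_tri (- s) y l \<inter> oriented_tri s y l') \<union> (oriented_tri s y l \<inter> oriented_tri (- s) y l')"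
  proof
    assume "flip_step (Pi_set N) T T'"
    from flip_step_diff[OF T this] obtain Xp Xm where "aff_dependent (Xp \<union> Xm)"
      "\<And>Y. Y \<in> T \<Longrightarrow> Y \<notin> T' \<Longrightarrow> Xm \<subseteq> Y" "\<And>Y. Y \<in> T' \<Longrightarrow> Y \<notin> T \<Longrightarrow> Xp \<subseteq> Y" by metis
    then have "Xm \<subseteq> oriented_tri (- s) y l" "Xm \<subseteq> oriented_tri s y l'" "Xp \<subseteq> oriented_tri s y l" "Xp \<subseteq> oriented_tri (- s) y l'" "aff_dependent (Xp \<union> Xm)"
      using 1 2 3 4 5 6 7 l'(2) by simp_all
    then show thesis by (intro that[of "Xp \<union> Xm"]) auto
  next
    assume "flip_step (Pi_set N) T' T"
    from flip_step_diff[OF T' this] obtain Xp Xm where "aff_dependent (Xp \<union> Xm)"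
      "\<And>Y. Y \<in> T' \<Longrightarrow> Y \<notin> T \<Longrightarrow> Xm \<subseteq> Y" "\<And>Y. Y \<in> T \<Longrightarrow> Y \<notin> T' \<Longrightarrow> Xp \<subseteq> Y" by metis
    then have "Xp \<subseteq> oriented_tri (- s) y l" "Xp \<subseteq> oriented_tri s y l'" "Xm \<subseteq> oriented_tri s y l" "Xm \<subseteq> oriented_tri (- s) y l'" "aff_dependent (Xp \<union> Xm)"
      using 1 2 3 4 5 6 7 l'(2) by simp_all
    then show thesis by (intro that[of "Xp \<union> Xm"]) auto
  qed
  have "X \<subseteq> {edge_pt i j r, edge_pt j i (- r)}" using X(2) ij(2,3) by blast
  then show False using edge_independent[OF ij(1)] X(1) by blast
qed

lemma signs_rtrancl:
  assumes "N \<ge> 7" "b = 1 \<or> b = -1" "(T, T') \<in> (flip_adj (Pi_set N))\<^sup>*" "signs b N T"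
  shows "signs b N T'"
  using assms(3,4) by (induction rule: rtrancl_induct) (use signs_adj[OF assms(1,2)] in blast)+

section \<open>A triangulation with prescribed signs\<close>

text \<open>Four numbers with sum 0 and with the signs of the lines at x, no two of which cancel: since
  one sign differs from the other three, they are 6, -2, -2, -2 up to order and sign. They are the
  sums of the local height function over the oriented facets.\<close>

definition face_weight :: "int \<Rightarrow> (nat \<Rightarrow> int) \<Rightarrow> nat \<Rightarrow> int" where
  "face_weight b x l = 4 * line_sign b x l - (line_sign b x 1 + line_sign b x 2 + line_sign b x 3 + line_sign b x 4)"

text \<open>The three arcs used lie in the oriented facets 2, 3 and 1, one in each. Their reversals
  form facet 4, whose sum comes out right because the four weights add up to 0.\<close>

definition local_weight_half :: "int \<Rightarrow> (nat \<Rightarrow> int) \<Rightarrow> nat \<Rightarrow> nat \<Rightarrow> int" where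
  "local_weight_half b x i j = (if i = 1 \<and> j = 3 then face_weight b x 2 else if i = 2 \<and> j = 1 then face_weight b x 3
     else if i = 3 \<and> j = 2 then face_weight b x 1 else 0)"

definition local_weight :: "int \<Rightarrow> (nat \<Rightarrow> int) \<Rightarrow> nat \<Rightarrow> nat \<Rightarrow> int" where
  "local_weight b x i j = local_weight_half b x i j - local_weight_half b x j i"

lemma local_weight_antisym: "local_weight b x j i = - local_weight b x i j"
  by (simp add: local_weight_def)

lemma face_weight_4: "face_weight b x 4 = - face_weight b x 1 - face_weight b x 2 - face_weight b x 3"
  by (simp add: face_weight_def)

lemma line_sign_prod:
  assumes "b = 1 \<or> b = -1"
  shows "line_sign b x 1 * line_sign b x 2 * line_sign b x 3 * line_sign b x 4 = -1"
proof -
  show ?thesis using assms by (elim disjE) (simp_all add: line_sign_def mult_ac)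
qed

lemma face_weight_signs:
  assumes b: "b = 1 \<or> b = -1" and l: "l \<in> {1..4}"
  shows "line_sign b x l = 1 \<Longrightarrow> face_weight b x l > 0" "line_sign b x l = -1 \<Longrightarrow> face_weight b x l < 0"
    "l' \<in> {1..4} \<Longrightarrow> l' \<noteq> l \<Longrightarrow> face_weight b x l + face_weight b x l' \<noteq> 0"
proof -
  define e where "e = line_sign b x"
  have e: "e 1 = 1 \<or> e 1 = -1" "e 2 = 1 \<or> e 2 = -1" "e 3 = 1 \<or> e 3 = -1" "e 4 = 1 \<or> e 4 = -1"
    "e 1 * e 2 * e 3 * e 4 = -1"
    unfolding e_def using line_sign_cases[OF b] line_sign_prod[OF b] by blast+
  define S where "S = e 1 + e 2 + e 3 + e 4"
  \<comment> \<open>The product -1 leaves one sign different from the other three. So a pair of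
    signs never adds up to -S, and a pair of weights adds up to 4 or -4.\<close>
  have S: "(S = 2 \<and> (\<forall>l\<in>{1..4}. \<forall>l'\<in>{1..4}. l \<noteq> l' \<longrightarrow> e l + e l' \<ge> 0)) \<or>
      (S = -2 \<and> (\<forall>l\<in>{1..4}. \<forall>l'\<in>{1..4}. l \<noteq> l' \<longrightarrow> e l + e l' \<le> 0))"
    unfolding S_def Ball_def index_cases using e by (elim disjE) simp_all
  have fw: "face_weight b x k = 4 * e k - S" for k by (simp add: face_weight_def e_def S_def)
  show "line_sign b x l = 1 \<Longrightarrow> face_weight b x l > 0" "line_sign b x l = -1 \<Longrightarrow> face_weight b x l < 0"
    using S unfolding fw e_def by auto
  show "face_weight b x l + face_weight b x l' \<noteq> 0" if "l' \<in> {1..4}" "l' \<noteq> l"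
  proof
    assume 0: "face_weight b x l + face_weight b x l' = 0"
    have "e l = 1 \<or> e l = -1" "e l' = 1 \<or> e l' = -1" unfolding e_def by (rule line_sign_cases[OF b])+
    then show False using 0 S that l unfolding fw by (elim disjE conjE) (force+)
  qed
qed

text \<open>Rotation keeps the sum and reversal negates it, so four oriented facets account for all
  ordered triples. That \<open>l\<close> and \<open>u\<close> are chosen before \<open>x\<close>
  lets heights at two vertices be compared.\<close>

lemma local_weight_triangle:
  assumes "i \<in> {1..4}" "j \<in> {1..4}" "k \<in> {1..4}" "i \<noteq> j" "j \<noteq> k" "k \<noteq> i"
  obtains l u where "l \<in> {1..4}" "l \<noteq> i" "l \<noteq> j" "l \<noteq> k" "u = 1 \<or> u = -1"
    "\<And>x. local_weight b x i j + local_weight b x j k + local_weight b x k i = u * face_weight b x l"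
proof -
  define Q where "Q = (\<lambda>i j k. \<exists>l u. l \<in> {1..4} \<and> l \<noteq> i \<and> l \<noteq> j \<and> l \<noteq> k \<and> (u = 1 \<or> u = -1) \<and>
    (\<forall>x. local_weight b x i j + local_weight b x j k + local_weight b x k i = u * face_weight b x l))"
  have QI: "Q i j k" if "l \<in> {1..4}" "l \<noteq> i" "l \<noteq> j" "l \<noteq> k" "u = 1 \<or> u = -1"
    "\<And>x. local_weight b x i j + local_weight b x j k + local_weight b x k i = u * face_weight b x l" for i j k l u
    unfolding Q_def using that by blast
  have rot: "Q j k i" and rev: "Q k j i" if Q: "Q i j k" for i j k
  proof -
    obtain l u where l: "l \<in> {1..4}" "l \<noteq> i" "l \<noteq> j" "l \<noteq> k" "u = 1 \<or> u = -1"
      and W: "\<And>x. local_weight b x i j + local_weight b x j k + local_weight b x k i = u * face_weight b x l"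
      using Q unfolding Q_def by blast
    show "Q j k i" by (rule QI[OF l(1,3,4,2,5)]) (use W in \<open>simp add: add_ac\<close>)
    have "- u = 1 \<or> - u = -1" using l(5) by auto
    moreover have "local_weight b x k j + local_weight b x j i + local_weight b x i k = - u * face_weight b x l" for x
      using W[of x] local_weight_antisym[of b x j i] local_weight_antisym[of b x k j] local_weight_antisym[of b x i k] by simp
    ultimately show "Q k j i" by (rule QI[OF l(1,4,3,2)])
  qed
  have all: "Q i j k \<and> Q j k i \<and> Q k i j \<and> Q k j i \<and> Q j i k \<and> Q i k j" if "Q i j k" for i j k
    using rot[OF that] rot[OF rot[OF that]] rev[OF that] rot[OF rev[OF that]] rot[OF rot[OF rev[OF that]]] that
    by simp
  have "Q 3 2 4" by (rule QI[of 1 _ _ _ 1]) (simp_all add: local_weight_def local_weight_half_def)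
  moreover have "Q 1 3 4" by (rule QI[of 2 _ _ _ 1]) (simp_all add: local_weight_def local_weight_half_def)
  moreover have "Q 2 1 4" by (rule QI[of 3 _ _ _ 1]) (simp_all add: local_weight_def local_weight_half_def)
  moreover have "Q 1 2 3" by (rule QI[of 4 _ _ _ 1]) (simp_all add: local_weight_def local_weight_half_def face_weight_4)
  ultimately have "Q i j k"
    using assms all[of 3 2 4] all[of 1 3 4] all[of 2 1 4] all[of 1 2 3]
    unfolding index_cases by (elim disjE) simp_all
  then show thesis using that unfolding Q_def by blast
qed

text \<open>The diagonal from \<open>i\<close> to \<open>k\<close> cuts the 4-cycle into the facets
  opposite to \<open>l\<close> and \<open>j\<close>, oriented alike, and their weights do not
  cancel.\<close>

lemma local_weight_square:
  assumes "i \<in> {1..4}" "j \<in> {1..4}" "k \<in> {1..4}" "l \<in> {1..4}"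
    "i \<noteq> j" "i \<noteq> k" "i \<noteq> l" "j \<noteq> k" "j \<noteq> l" "k \<noteq> l" "b = 1 \<or> b = -1"
  shows "local_weight b x i j + local_weight b x j k + local_weight b x k l + local_weight b x l i \<noteq> 0"
proof -
  have "local_weight b x i j + local_weight b x j k + local_weight b x k l + local_weight b x l i = face_weight b x j + face_weight b x l \<or>
      local_weight b x i j + local_weight b x j k + local_weight b x k l + local_weight b x l i = - (face_weight b x j + face_weight b x l)"
    using assms(1-10) unfolding index_cases
    by (elim disjE) (simp_all add: local_weight_def local_weight_half_def face_weight_4)
  then show ?thesis using face_weight_signs(3)[OF assms(11,4,2) assms(9), of x] by linarith
qed

text \<open>On each f, the points of lexicographically minimal cost relative to the potentials x (for the
  arrangement) and y (for the local height function at x).\<close>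

definition cell :: "int \<Rightarrow> nat \<Rightarrow> (nat \<Rightarrow> int) \<Rightarrow> (nat \<Rightarrow> int) \<Rightarrow> (coord \<Rightarrow> real) set" where
  "cell b N x y = {edge_pt i j r | i j r. (i, j, r) \<in> arcs N \<and>
     (r < x i - x j \<or> r = x i - x j \<and> local_weight b x i j \<le> y i - y j)}"

definition tiling :: "int \<Rightarrow> nat \<Rightarrow> (coord \<Rightarrow> real) set set" where
  "tiling b N = {\<sigma>. \<exists>x y. \<sigma> \<subseteq> cell b N x y}"

section \<open>Affine independence and intersections of cells\<close>

lemma edge_pt_in_cell:
  assumes "edge_pt i j r \<in> cell b N x y" "i \<noteq> j"
  shows "(i, j, r) \<in> arcs N" "r \<le> x i - x j" "r = x i - x j \<Longrightarrow> local_weight b x i j \<le> y i - y j"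
proof -
  obtain i' j' r' where *: "edge_pt i j r = edge_pt i' j' r'" "(i', j', r') \<in> arcs N"
    "r' < x i' - x j' \<or> r' = x i' - x j' \<and> local_weight b x i' j' \<le> y i' - y j'"
    using assms unfolding cell_def by blast
  then have "i' \<noteq> j'" by (simp add: arcs_def)
  then have "i' = i" "j' = j" "r' = r" using *(1) assms(2) by (simp_all add: edge_pt_inject)
  then show "(i, j, r) \<in> arcs N" "r \<le> x i - x j" "r = x i - x j \<Longrightarrow> local_weight b x i j \<le> y i - y j"
    using * by auto
qed

lemma line_sign_cong:
  assumes "\<And>i j. i \<in> {1..4} \<Longrightarrow> j \<in> {1..4} \<Longrightarrow> i \<noteq> l \<Longrightarrow> j \<noteq> l \<Longrightarrow> x i - x j = x' i - x' j" "l \<in> {1..4}"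
  shows "line_sign b x l = line_sign b x' l"
proof -
  have "x i - x j = x' i - x' j" if "i \<in> {1,2,3,4}" "j \<in> {1,2,3,4}" "i \<noteq> l" "j \<noteq> l" for i j
    using assms(1) that by auto
  then show ?thesis using assms(2) unfolding index_cases line_sign_def by auto
qed

text \<open>Equal differences on the triangle put \<open>x\<close> and \<open>x'\<close> on a common
  line, up to translation. Its sign is the same at both and determines the strict sign of both
  cyclic sums. This is the compatibility that glues the heights of different vertices.\<close>

lemma local_weight_triangle_consistent:
  assumes b: "b = 1 \<or> b = -1" and d: "i \<in> {1..4}" "j \<in> {1..4}" "k \<in> {1..4}" "i \<noteq> j" "j \<noteq> k" "k \<noteq> i"
    and eq: "x i - x j = x' i - x' j" "x j - x k = x' j - x' k"
    and le: "local_weight b x i j + local_weight b x j k + local_weight b x k i \<le> 0" "0 \<le> local_weight b x' i j + local_weight b x' j k + local_weight b x' k i"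
  shows False
proof -
  obtain l u where l: "l \<in> {1..4}" "l \<noteq> i" "l \<noteq> j" "l \<noteq> k" and u: "u = 1 \<or> u = -1"
    and W: "\<And>x. local_weight b x i j + local_weight b x j k + local_weight b x k i = u * face_weight b x l"
    by (rule local_weight_triangle[OF d, of b]) (rule that, assumption+)
  have "{i, j, k, l} = {1..4}" using d l by (intro card_subset_eq) auto
  then have m: "m = i \<or> m = j \<or> m = k" if "m \<in> {1..4}" "m \<noteq> l" for m
    using that by blast
  have "x m - x n = x' m - x' n" if "m \<in> {1..4}" "n \<in> {1..4}" "m \<noteq> l" "n \<noteq> l" for m n
    using m[OF that(1,3)] m[OF that(2,4)] eq by auto
  then have "line_sign b x l = line_sign b x' l" by (intro line_sign_cong l(1))
  then have "(face_weight b x l > 0 \<and> face_weight b x' l > 0) \<or> (face_weight b x l < 0 \<and> face_weight b x' l < 0)"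
    using face_weight_signs(1,2)[OF b l(1)] line_sign_cases[OF b, of x l] by metis
  then show False using le u unfolding W by auto
qed

text \<open>Two of five successive iterates coincide, as there are four vertices; length 1 is
  excluded because \<open>s\<close> has no fixed point.\<close>

lemma functional_cycle:
  fixes V :: "nat set"
  assumes V: "V \<subseteq> {1..4}" "v0 \<in> V" and s: "\<And>v. v \<in> V \<Longrightarrow> s v \<in> V \<and> s v \<noteq> v"
  obtains (two) i j where "i \<in> V" "j \<in> V" "i \<noteq> j" "s i = j" "s j = i"
  | (three) i j k where "i \<in> V" "j \<in> V" "k \<in> V" "i \<noteq> j" "j \<noteq> k" "k \<noteq> i" "s i = j" "s j = k" "s k = i"
  | (four) i j k l where "i \<in> V" "j \<in> V" "k \<in> V" "l \<in> V" "i \<noteq> j" "i \<noteq> k" "i \<noteq> l" "j \<noteq> k" "j \<noteq> l" "k \<noteq> l"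
      "s i = j" "s j = k" "s k = l" "s l = i"
proof -
  define v1 where "v1 = s v0"
  define v2 where "v2 = s v1"
  define v3 where "v3 = s v2"
  define v4 where "v4 = s v3"
  have mem: "v1 \<in> V" "v2 \<in> V" "v3 \<in> V" "v4 \<in> V"
    using V(2) s by (auto simp: v1_def v2_def v3_def v4_def)
  have ne: "v0 \<noteq> v1" "v1 \<noteq> v2" "v2 \<noteq> v3" "v3 \<noteq> v4"
    using s[OF V(2)] s[OF mem(1)] s[OF mem(2)] s[OF mem(3)] by (simp_all add: v1_def v2_def v3_def v4_def)
  have step: "s v0 = v1" "s v1 = v2" "s v2 = v3" "s v3 = v4" by (simp_all add: v1_def v2_def v3_def v4_def)
  have pigeon: "\<not> (v0 \<noteq> v2 \<and> v0 \<noteq> v3 \<and> v0 \<noteq> v4 \<and> v1 \<noteq> v3 \<and> v1 \<noteq> v4 \<and> v2 \<noteq> v4)"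
  proof
    assume "v0 \<noteq> v2 \<and> v0 \<noteq> v3 \<and> v0 \<noteq> v4 \<and> v1 \<noteq> v3 \<and> v1 \<noteq> v4 \<and> v2 \<noteq> v4"
    then have "card {v0, v1, v2, v3, v4} = 5" using ne by simp
    moreover have "card {v0, v1, v2, v3, v4} \<le> card {1..4::nat}"
      using V mem by (intro card_mono) auto
    ultimately show False by simp
  qed
  show thesis
  proof (cases "v0 = v2 \<or> v1 = v3 \<or> v2 = v4")
    case True
    then show ?thesis using two[of v0 v1] two[of v1 v2] two[of v2 v3] mem V(2) ne step by auto
  next
    case False
    then consider "v0 = v3" | "v1 = v4" | "v0 = v4" "v0 \<noteq> v3" "v1 \<noteq> v4" using pigeon by blast
    then show ?thesis
    proof cases
      case 1
      then show ?thesis using three[of v0 v1 v2] mem V(2) ne step False by auto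
    next
      case 2
      then show ?thesis using three[of v1 v2 v3] mem V(2) ne step False by auto
    next
      case 3
      then show ?thesis using four[of v0 v1 v2 v3] mem V(2) ne step False by auto
    qed
  qed
qed

text \<open>The positive arcs of a circulation contain a directed cycle; its arcs lie in the first
  cell and their reversals in the second. Around the cycle potentials telescope to 0, which bounds
  the sum of the labels from both sides. So all its arcs are tight for \<open>x\<close> and for
  \<open>x'\<close>, and the local heights have to decide.\<close>

lemma no_dependence:
  fixes d :: "nat \<times> nat \<times> int \<Rightarrow> real"
  assumes b: "b = 1 \<or> b = -1"
    and pair: "\<And>a. a \<in> arcs N \<Longrightarrow> d a + d (arc_rev a) = 0"
    and vert: "\<And>k. k \<in> {1..4} \<Longrightarrow> (\<Sum>a | a \<in> arcs N \<and> fst a = k. d a) = 0"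
    and pos: "\<And>a. a \<in> arcs N \<Longrightarrow> d a > 0 \<Longrightarrow> arc_pt a \<in> cell b N x y"
    and neg: "\<And>a. a \<in> arcs N \<Longrightarrow> d a < 0 \<Longrightarrow> arc_pt a \<in> cell b N x' y'"
    and a: "a \<in> arcs N"
  shows "d a = 0"
proof (rule ccontr)
  assume "d a \<noteq> 0"
  define V where "V = {i. \<exists>j r. (i, j, r) \<in> arcs N \<and> d (i, j, r) > 0}"
  have "\<exists>a\<in>arcs N. d a > 0"
  proof (cases "d a > 0")
    case False
    then have "d (arc_rev a) > 0" using pair[OF a] \<open>d a \<noteq> 0\<close> by simp
    then show ?thesis using a by (intro bexI[of _ "arc_rev a"]) auto
  qed (use a in blast)
  then obtain v0 where v0: "v0 \<in> V" unfolding V_def by auto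
  have "\<exists>j r. (i, j, r) \<in> arcs N \<and> d (i, j, r) > 0" if "i \<in> V" for i using that by (simp add: V_def)
  then obtain s \<rho> where s: "\<And>i. i \<in> V \<Longrightarrow> (i, s i, \<rho> i) \<in> arcs N" "\<And>i. i \<in> V \<Longrightarrow> d (i, s i, \<rho> i) > 0"
    by metis
  have V: "V \<subseteq> {1..4}" by (auto simp: V_def arcs_def)
  \<comment> \<open>A positive arc into \<open>s i\<close> has a negative reversal leaving
    \<open>s i\<close>; the zero sum at \<open>s i\<close> then needs a positive arc leaving
    it.\<close>
  have nxt: "s i \<in> V" "s i \<noteq> i" if i: "i \<in> V" for i
  proof -
    have a: "(s i, i, - \<rho> i) \<in> arcs N" using s(1)[OF i] by (auto simp: arcs_def)
    have "d (s i, i, - \<rho> i) < 0" using pair[OF s(1)[OF i]] s(2)[OF i] by simp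
    moreover have "(\<Sum>a | a \<in> arcs N \<and> fst a = s i. d a) = 0" using a by (intro vert) (auto simp: arcs_def)
    ultimately have "\<exists>a. a \<in> arcs N \<and> fst a = s i \<and> d a > 0"
    proof -
      define A where "A = {a \<in> arcs N. fst a = s i}"
      have A: "finite A" "(s i, i, - \<rho> i) \<in> A" using a by (auto simp: A_def)
      have "(\<Sum>a\<in>A. d a) = d (s i, i, - \<rho> i) + (\<Sum>a\<in>A - {(s i, i, - \<rho> i)}. d a)"
        using A by (rule sum.remove)
      then have "\<not> (\<Sum>a\<in>A - {(s i, i, - \<rho> i)}. d a) \<le> 0"
        using \<open>(\<Sum>a | a \<in> arcs N \<and> fst a = s i. d a) = 0\<close> \<open>d (s i, i, - \<rho> i) < 0\<close>
        unfolding A_def by linarith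
      then obtain a' where "a' \<in> A - {(s i, i, - \<rho> i)}" "\<not> d a' \<le> 0"
        by (meson sum_nonpos)
      then show ?thesis by (intro exI[of _ a']) (auto simp: A_def not_le)
    qed
    then show "s i \<in> V" unfolding V_def by force
    show "s i \<noteq> i" using s(1)[OF i] by (simp add: arcs_def)
  qed
  have up: "\<rho> i \<le> x i - x (s i)" "\<rho> i = x i - x (s i) \<Longrightarrow> local_weight b x i (s i) \<le> y i - y (s i)" if "i \<in> V" for i
    using edge_pt_in_cell[of i "s i" "\<rho> i" b N x y] pos[OF s(1)[OF that] s(2)[OF that]] nxt[OF that] by auto
  have down: "x' i - x' (s i) \<le> \<rho> i" "\<rho> i = x' i - x' (s i) \<Longrightarrow> y' i - y' (s i) \<le> local_weight b x' i (s i)" if "i \<in> V" for i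
  proof -
    have r: "(s i, i, - \<rho> i) \<in> arcs N" using s(1)[OF that] by (auto simp: arcs_def)
    have "d (s i, i, - \<rho> i) < 0" using pair[OF s(1)[OF that]] s(2)[OF that] by simp
    then have "edge_pt (s i) i (- \<rho> i) \<in> cell b N x' y'" using neg[OF r] by simp
    from edge_pt_in_cell[OF this] nxt[OF that] show "x' i - x' (s i) \<le> \<rho> i"
      "\<rho> i = x' i - x' (s i) \<Longrightarrow> y' i - y' (s i) \<le> local_weight b x' i (s i)"
      using local_weight_antisym[of b x' "s i" i] by auto
  qed
  show False
  proof (rule functional_cycle[of V v0 s, OF V v0])
    show "s v \<in> V \<and> s v \<noteq> v" if "v \<in> V" for v using nxt[OF that] by simp
  next
    \<comment> \<open>Tightness makes the two arcs reversals of each other, and these cannot both be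
      positive.\<close>
    fix i j assume two: "i \<in> V" "j \<in> V" "i \<noteq> j" "s i = j" "s j = i"
    have "\<rho> j = - \<rho> i" using up(1)[of i] up(1)[of j] down(1)[of i] down(1)[of j] two by simp
    then show False using s(2)[of j] s(2)[of i] pair[OF s(1)[of i]] two by simp
  next
    fix i j k assume three: "i \<in> V" "j \<in> V" "k \<in> V" "i \<noteq> j" "j \<noteq> k" "k \<noteq> i" "s i = j" "s j = k" "s k = i"
    have eq: "x i - x j = \<rho> i" "x j - x k = \<rho> j" "x k - x i = \<rho> k"
      "x' i - x' j = \<rho> i" "x' j - x' k = \<rho> j" "x' k - x' i = \<rho> k"
      using up(1)[of i] up(1)[of j] up(1)[of k] down(1)[of i] down(1)[of j] down(1)[of k] three by simp_all
    have "local_weight b x i j + local_weight b x j k + local_weight b x k i \<le> 0"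
      using up(2)[of i] up(2)[of j] up(2)[of k] three eq by simp
    moreover have "0 \<le> local_weight b x' i j + local_weight b x' j k + local_weight b x' k i"
      using down(2)[of i] down(2)[of j] down(2)[of k] three eq by simp
    ultimately show False
      using three V eq by (intro local_weight_triangle_consistent[OF b, of i j k x x']) auto
  next
    fix i j k l assume four: "i \<in> V" "j \<in> V" "k \<in> V" "l \<in> V" "i \<noteq> j" "i \<noteq> k" "i \<noteq> l" "j \<noteq> k" "j \<noteq> l" "k \<noteq> l"
      "s i = j" "s j = k" "s k = l" "s l = i"
    have eq: "x i - x j = \<rho> i" "x j - x k = \<rho> j" "x k - x l = \<rho> k" "x l - x i = \<rho> l"
      "x' i - x' j = \<rho> i" "x' j - x' k = \<rho> j" "x' k - x' l = \<rho> k" "x' l - x' i = \<rho> l"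
      using up(1)[of i] up(1)[of j] up(1)[of k] up(1)[of l] down(1)[of i] down(1)[of j] down(1)[of k] down(1)[of l] four
      by simp_all
    \<comment> \<open>All differences agree, so \<open>x\<close> and \<open>x'\<close> are
      translates with the same heights, and one and the same cyclic sum is bounded by 0 from both
      sides.\<close>
    have all: "m \<in> {i, j, k, l}" if "m \<in> {1..4}" for m
    proof -
      have "{i, j, k, l} = {1..4}"
        using four V by (intro card_subset_eq) auto
      then show ?thesis using that by simp
    qed
    have "x m - x n = x' m - x' n" if "m \<in> {1..4}" "n \<in> {1..4}" for m n
      using all[OF that(1)] all[OF that(2)] eq by auto
    then have "line_sign b x m = line_sign b x' m" if "m \<in> {1..4}" for m
      by (intro line_sign_cong that)
    then have "face_weight b x m = face_weight b x' m" if "m \<in> {1..4}" for m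
      using that by (simp add: face_weight_def)
    then have "local_weight b x m n = local_weight b x' m n" for m n by (simp add: local_weight_def local_weight_half_def)
    moreover have "local_weight b x i j + local_weight b x j k + local_weight b x k l + local_weight b x l i \<le> 0"
      using up(2)[of i] up(2)[of j] up(2)[of k] up(2)[of l] four eq by simp
    moreover have "0 \<le> local_weight b x' i j + local_weight b x' j k + local_weight b x' k l + local_weight b x' l i"
      using down(2)[of i] down(2)[of j] down(2)[of k] down(2)[of l] four eq by simp
    ultimately have "local_weight b x i j + local_weight b x j k + local_weight b x k l + local_weight b x l i = 0" by simp
    then show False using local_weight_square[of i j k l b x] four V b by blast
  qed
qed

lemma cell_subset: "cell b N x y \<subseteq> Pi_set N"
  unfolding cell_def by (auto intro: edge_pt_in_Pi_set)

text \<open>With \<sigma> = \<sigma>' this gives affine independence. Applied to the difference of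
  two representations of a point it makes them equal, which gives the intersection property.\<close>

lemma no_dependence_points:
  fixes d :: "(coord \<Rightarrow> real) \<Rightarrow> real"
  assumes b: "b = 1 \<or> b = -1"
    and zero: "\<And>c. (\<Sum>x\<in>Pi_set N. d x * x c) = 0"
    and pos: "\<And>x. x \<in> Pi_set N \<Longrightarrow> d x > 0 \<Longrightarrow> x \<in> \<sigma>" and neg: "\<And>x. x \<in> Pi_set N \<Longrightarrow> d x < 0 \<Longrightarrow> x \<in> \<sigma>'"
    and mem: "\<sigma> \<in> tiling b N" "\<sigma>' \<in> tiling b N" and x: "x \<in> Pi_set N"
  shows "d x = 0"
proof -
  obtain y z y' z' where cells: "\<sigma> \<subseteq> cell b N y z" "\<sigma>' \<subseteq> cell b N y' z'"
    using mem unfolding tiling_def by blast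
  obtain a where a: "a \<in> arcs N" "x = arc_pt a" using x unfolding Pi_set_eq by blast
  have eq: "(\<Sum>x\<in>Pi_set N. d x * x c) = (\<Sum>x\<in>Pi_set N. 0 * x c)" for c using zero by simp
  have "(\<lambda>a. d (arc_pt a)) a = 0"
  proof (rule no_dependence[OF b, where N = N and x = y and y = z and x' = y' and y' = z'])
    show "d (arc_pt a) + d (arc_pt (arc_rev a)) = 0" if "a \<in> arcs N" for a
      using same_point_pair[OF eq that] by simp
    show "(\<Sum>a | a \<in> arcs N \<and> fst a = k. d (arc_pt a)) = 0" for k
      using zero[of "E k"] by (simp add: sum_Pi_set_E)
    show "arc_pt a \<in> cell b N y z" if "a \<in> arcs N" "d (arc_pt a) > 0" for a
      using pos[OF _ that(2)] cells(1) that(1) unfolding Pi_set_eq by blast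
    show "arc_pt a \<in> cell b N y' z'" if "a \<in> arcs N" "d (arc_pt a) < 0" for a
      using neg[OF _ that(2)] cells(2) that(1) unfolding Pi_set_eq by blast
  qed (rule a(1))
  then show ?thesis using a by simp
qed

lemma tiling_simplex:
  assumes b: "b = 1 \<or> b = -1" and mem: "\<sigma> \<in> tiling b N"
  shows "is_simplex (Pi_set N) \<sigma>"
  unfolding is_simplex_def
proof
  show sub: "\<sigma> \<subseteq> Pi_set N" using mem cell_subset unfolding tiling_def by blast
  show "\<not> aff_dependent \<sigma>"
  proof
    assume "aff_dependent \<sigma>"
    then obtain Z \<mu> x where Z: "Z \<subseteq> \<sigma>" "\<And>c. (\<Sum>x\<in>Z. \<mu> x * x c) = 0" "x \<in> Z" "\<mu> x \<noteq> 0"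
      unfolding aff_dependent_def by blast
    define d where "d = (\<lambda>x. if x \<in> Z then \<mu> x else 0)"
    have zero: "(\<Sum>x\<in>Pi_set N. d x * x c) = 0" for c
    proof -
      have "(\<Sum>x\<in>Pi_set N. d x * x c) = (\<Sum>x\<in>Z. \<mu> x * x c)"
        using sub Z(1) by (intro sum.mono_neutral_cong_right) (auto simp: d_def)
      then show ?thesis using Z(2) by simp
    qed
    have "d x = 0"
      by (rule no_dependence_points[OF b zero _ _ mem mem]) (use Z sub in \<open>auto simp: d_def split: if_splits\<close>)
    then show False using Z by (simp add: d_def)
  qed
qed

lemma tiling_down: "\<sigma> \<in> tiling b N \<Longrightarrow> G \<subseteq> \<sigma> \<Longrightarrow> G \<in> tiling b N"
  unfolding tiling_def by blast

lemma tiling_inter: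
  assumes b: "b = 1 \<or> b = -1" and mem: "\<sigma> \<in> tiling b N" "\<sigma>' \<in> tiling b N"
  shows "conv \<sigma> \<inter> conv \<sigma>' = conv (\<sigma> \<inter> \<sigma>')"
proof
  have sub: "\<sigma> \<subseteq> Pi_set N" "\<sigma>' \<subseteq> Pi_set N" using tiling_simplex[OF b] mem by (auto simp: is_simplex_def)
  show "conv \<sigma> \<inter> conv \<sigma>' \<subseteq> conv (\<sigma> \<inter> \<sigma>')"
  proof (rule subsetI, elim IntE)
    fix p assume p: "p \<in> conv \<sigma>" "p \<in> conv \<sigma>'"
    obtain \<mu> where \<mu>: "\<And>x. 0 \<le> \<mu> x" "\<And>x. x \<notin> \<sigma> \<Longrightarrow> \<mu> x = 0" "(\<Sum>x\<in>Pi_set N. \<mu> x) = 1"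
      "\<And>c. p c = (\<Sum>x\<in>Pi_set N. \<mu> x * x c)" by (rule conv_subset_Pi[OF sub(1) p(1)]) (rule that)
    obtain \<nu> where \<nu>: "\<And>x. 0 \<le> \<nu> x" "\<And>x. x \<notin> \<sigma>' \<Longrightarrow> \<nu> x = 0" "(\<Sum>x\<in>Pi_set N. \<nu> x) = 1"
      "\<And>c. p c = (\<Sum>x\<in>Pi_set N. \<nu> x * x c)" by (rule conv_subset_Pi[OF sub(2) p(2)]) (rule that)
    have zero: "(\<Sum>x\<in>Pi_set N. (\<mu> x - \<nu> x) * x c) = 0" for c
      using \<mu>(4)[of c] \<nu>(4)[of c] by (simp add: left_diff_distrib sum_subtractf)
    have eq: "\<mu> x - \<nu> x = 0" if "x \<in> Pi_set N" for x
    proof (rule no_dependence_points[OF b zero _ _ mem that])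
      fix x
      show "x \<in> \<sigma>" if "0 < \<mu> x - \<nu> x" using that \<mu>(2)[of x] \<nu>(1)[of x] by force
      show "x \<in> \<sigma>'" if "\<mu> x - \<nu> x < 0" using that \<nu>(2)[of x] \<mu>(1)[of x] by force
    qed
    show "p \<in> conv (\<sigma> \<inter> \<sigma>')"
    proof (rule conv_subset_PiI[of _ N \<mu>])
      show "\<mu> x = 0" if "x \<in> Pi_set N" "x \<notin> \<sigma> \<inter> \<sigma>'" for x
        using that eq[OF that(1)] \<mu>(2)[of x] \<nu>(2)[of x] by auto
    qed (use sub \<mu> in auto)
  qed
  show "conv (\<sigma> \<inter> \<sigma>') \<subseteq> conv \<sigma> \<inter> conv \<sigma>'"
  proof
    fix p assume p: "p \<in> conv (\<sigma> \<inter> \<sigma>')"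
    have "\<sigma> \<inter> \<sigma>' \<subseteq> Pi_set N" using sub by blast
    then obtain \<mu> where \<mu>: "\<And>x. 0 \<le> \<mu> x" "\<And>x. x \<notin> \<sigma> \<inter> \<sigma>' \<Longrightarrow> \<mu> x = 0" "(\<Sum>x\<in>Pi_set N. \<mu> x) = 1"
      "\<And>c. p c = (\<Sum>x\<in>Pi_set N. \<mu> x * x c)" by (rule conv_subset_Pi[OF _ p]) (rule that)
    show "p \<in> conv \<sigma> \<inter> conv \<sigma>'"
      using conv_subset_PiI[OF sub(1) \<mu>(1) _ \<mu>(3,4)] conv_subset_PiI[OF sub(2) \<mu>(1) _ \<mu>(3,4)] \<mu>(2) by auto
  qed
qed

section \<open>Integer potentials for difference constraints\<close>

lemma potential3:
  fixes m :: "nat \<Rightarrow> nat \<Rightarrow> int"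
  assumes "m 1 2 + m 2 1 \<le> 0" "m 1 3 + m 3 1 \<le> 0" "m 2 3 + m 3 2 \<le> 0"
    "m 1 2 + m 2 3 + m 3 1 \<le> 0" "m 1 3 + m 3 2 + m 2 1 \<le> 0"
  shows "\<exists>x1 x2 x3. m 1 2 \<le> x1 - x2 \<and> m 2 1 \<le> x2 - x1 \<and> m 1 3 \<le> x1 - x3 \<and> m 3 1 \<le> x3 - x1 \<and>
    m 2 3 \<le> x2 - x3 \<and> m 3 2 \<le> x3 - x2"
proof -
  \<comment> \<open>Longest paths with the second potential set to 0: \<open>u\<close> is the least
    value then possible for the first, and \<open>v\<close> the least for the third once the first
    is \<open>u\<close>.\<close>
  define u where "u = max (m 1 2) (m 1 3 + m 3 2)"
  define v where "v = max (m 3 1 + u) (m 3 2)"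
  have "m 1 2 \<le> u - 0 \<and> m 2 1 \<le> 0 - u \<and> m 1 3 \<le> u - v \<and> m 3 1 \<le> v - u \<and> m 2 3 \<le> 0 - v \<and> m 3 2 \<le> v - 0"
    using assms unfolding v_def u_def by (simp add: max_def)
  then show ?thesis by blast
qed

text \<open>Elimination of vertex 4: \<open>n\<close> includes the detours through 4, and a cycle
  for \<open>n\<close> expands into a closed walk that splits into cycles for
  \<open>m\<close>.\<close>

lemma potential4:
  fixes m :: "nat \<Rightarrow> nat \<Rightarrow> int"
  assumes c2: "\<And>i j. i \<in> {1..4} \<Longrightarrow> j \<in> {1..4} \<Longrightarrow> i \<noteq> j \<Longrightarrow> m i j + m j i \<le> 0"
    and c3: "\<And>i j k. i \<in> {1..4} \<Longrightarrow> j \<in> {1..4} \<Longrightarrow> k \<in> {1..4} \<Longrightarrow> i \<noteq> j \<Longrightarrow> j \<noteq> k \<Longrightarrow> k \<noteq> i \<Longrightarrow>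
       m i j + m j k + m k i \<le> 0"
    and c4: "\<And>i j k l. i \<in> {1..4} \<Longrightarrow> j \<in> {1..4} \<Longrightarrow> k \<in> {1..4} \<Longrightarrow> l \<in> {1..4} \<Longrightarrow> i \<noteq> j \<Longrightarrow> i \<noteq> k \<Longrightarrow> i \<noteq> l \<Longrightarrow>
       j \<noteq> k \<Longrightarrow> j \<noteq> l \<Longrightarrow> k \<noteq> l \<Longrightarrow> m i j + m j k + m k l + m l i \<le> 0"
  shows "\<exists>x. \<forall>i\<in>{1..4}. \<forall>j\<in>{1..4}. i \<noteq> j \<longrightarrow> m i j \<le> x i - x j"
proof -
  define n where "n = (\<lambda>i j. max (m i j) (m i 4 + m 4 j))"
  have n2: "n i j + n j i \<le> 0" if "i \<in> {1..4}" "j \<in> {1..4}" "i \<noteq> j" "i \<noteq> 4" "j \<noteq> 4" for i j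
    using c2[OF that(1-3)] c3[of i 4 j] c3[of j 4 i] c2[of i 4] c2[of j 4] that
    unfolding n_def by (simp add: max_def)
  have n3: "n i j + n j k + n k i \<le> 0"
    if "i \<in> {1..4}" "j \<in> {1..4}" "k \<in> {1..4}" "i \<noteq> j" "j \<noteq> k" "k \<noteq> i" "i \<noteq> 4" "j \<noteq> 4" "k \<noteq> 4" for i j k
    using c3[OF that(1-6)] c4[of i 4 j k] c4[of i j 4 k] c4[of i j k 4] c2[of i 4] c2[of j 4] c2[of k 4]
      c3[of i 4 j] c3[of j 4 k] c3[of k 4 i] c3[of i j 4] c3[of j k 4] c3[of k i 4] that
    unfolding n_def by (simp add: max_def)
  obtain x1 x2 x3 where x: "n 1 2 \<le> x1 - x2" "n 2 1 \<le> x2 - x1" "n 1 3 \<le> x1 - x3" "n 3 1 \<le> x3 - x1"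
    "n 2 3 \<le> x2 - x3" "n 3 2 \<le> x3 - x2"
    using potential3[of n] n2[of 1 2] n2[of 1 3] n2[of 2 3] n3[of 1 2 3] n3[of 1 3 2] by auto
  \<comment> \<open>The least value that the lower bounds allow. The upper bounds on it follow from
    the detours in \<open>n\<close> and from the 2-cycles through 4.\<close>
  define x4 where "x4 = max (m 4 1 + x1) (max (m 4 2 + x2) (m 4 3 + x3))"
  define x where "x = (\<lambda>i::nat. if i = 1 then x1 else if i = 2 then x2 else if i = 3 then x3 else x4)"
  have up: "m 4 1 \<le> x4 - x1" "m 4 2 \<le> x4 - x2" "m 4 3 \<le> x4 - x3" unfolding x4_def by linarith+
  have "m 1 4 \<le> x1 - x4" "m 2 4 \<le> x2 - x4" "m 3 4 \<le> x3 - x4"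
    using x c2[of 1 4] c2[of 2 4] c2[of 3 4] unfolding x4_def n_def by auto
  then have "m i j \<le> x i - x j" if "i \<in> {1..4}" "j \<in> {1..4}" "i \<noteq> j" for i j
    using that up x unfolding index_cases n_def x_def by (elim disjE) simp_all
  then show ?thesis by blast
qed

lemma potentials_exist:
  fixes S :: "nat \<Rightarrow> nat \<Rightarrow> int \<Rightarrow> bool"
  assumes bound: "\<And>i j r. S i j r \<Longrightarrow> \<bar>r\<bar> \<le> M"
    and c2: "\<And>i j r s. i \<noteq> j \<Longrightarrow> S i j r \<Longrightarrow> S j i s \<Longrightarrow> r + s \<le> 0"
    and c3: "\<And>i j k r s t. i \<noteq> j \<Longrightarrow> j \<noteq> k \<Longrightarrow> k \<noteq> i \<Longrightarrow>
       S i j r \<Longrightarrow> S j k s \<Longrightarrow> S k i t \<Longrightarrow> r + s + t \<le> 0"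
    and c4: "\<And>i j k l r s t u. i \<noteq> j \<Longrightarrow> i \<noteq> k \<Longrightarrow> i \<noteq> l \<Longrightarrow> j \<noteq> k \<Longrightarrow> j \<noteq> l \<Longrightarrow> k \<noteq> l \<Longrightarrow>
       S i j r \<Longrightarrow> S j k s \<Longrightarrow> S k l t \<Longrightarrow> S l i u \<Longrightarrow> r + s + t + u \<le> 0"
  shows "\<exists>x. \<forall>i\<in>{1..4}. \<forall>j\<in>{1..4}. i \<noteq> j \<longrightarrow> (\<forall>r. S i j r \<longrightarrow> r \<le> x i - x j)"
proof -
  \<comment> \<open>A missing constraint gets -4 |M|: the other terms of a cycle of length at most 4
    add up to at most 3 |M|, so every cycle through it has a nonpositive sum.\<close>
  define m where "m = (\<lambda>i j. if \<exists>r. S i j r then Max {r. S i j r} else - 4 * \<bar>M\<bar>)"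
  have fin: "finite {r. S i j r}" for i j
  proof (rule finite_subset[of _ "{-M..M}"])
    show "{r. S i j r} \<subseteq> {-M..M}" using bound[of i j] by (auto simp: abs_le_iff minus_le_iff)
  qed simp
  have ge: "r \<le> m i j" if "S i j r" for i j r
    using that Max_ge[OF fin[of i j], of r] by (auto simp: m_def)
  have m: "S i j (m i j) \<and> \<bar>m i j\<bar> \<le> M \<or> m i j = - 4 * \<bar>M\<bar>" for i j
  proof (cases "\<exists>r. S i j r")
    case True
    then have "Max {r. S i j r} \<in> {r. S i j r}" by (intro Max_in fin) auto
    then show ?thesis using True bound by (simp add: m_def)
  next
    case False
    then show ?thesis unfolding m_def by (simp only: if_False) simp
  qed
  have le: "m i j \<le> \<bar>M\<bar>" for i j using m[of i j] by linarith
  have "\<exists>x. \<forall>i\<in>{1..4}. \<forall>j\<in>{1..4}. i \<noteq> j \<longrightarrow> m i j \<le> x i - x j"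
  proof (rule potential4)
    show "m i j + m j i \<le> 0" if "i \<noteq> j" for i j
    proof (cases "S i j (m i j) \<and> S j i (m j i)")
      case True
      then show ?thesis using c2[OF that] by blast
    next
      case False
      then have "m i j = - 4 * \<bar>M\<bar> \<or> m j i = - 4 * \<bar>M\<bar>" using m by blast
      then show ?thesis using le[of i j] le[of j i] by linarith
    qed
    show "m i j + m j k + m k i \<le> 0" if "i \<noteq> j" "j \<noteq> k" "k \<noteq> i" for i j k
    proof (cases "S i j (m i j) \<and> S j k (m j k) \<and> S k i (m k i)")
      case True
      then show ?thesis using c3[OF that] by blast
    next
      case False
      then have "m i j = - 4 * \<bar>M\<bar> \<or> m j k = - 4 * \<bar>M\<bar> \<or> m k i = - 4 * \<bar>M\<bar>" using m by blast
      then show ?thesis using le[of i j] le[of j k] le[of k i] by linarith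
    qed
    show "m i j + m j k + m k l + m l i \<le> 0"
      if "i \<noteq> j" "i \<noteq> k" "i \<noteq> l" "j \<noteq> k" "j \<noteq> l" "k \<noteq> l" for i j k l
    proof (cases "S i j (m i j) \<and> S j k (m j k) \<and> S k l (m k l) \<and> S l i (m l i)")
      case True
      then show ?thesis using c4[OF that] by blast
    next
      case False
      then have "m i j = - 4 * \<bar>M\<bar> \<or> m j k = - 4 * \<bar>M\<bar> \<or> m k l = - 4 * \<bar>M\<bar> \<or> m l i = - 4 * \<bar>M\<bar>"
        using m by blast
      then show ?thesis using le[of i j] le[of j k] le[of k l] le[of l i] by linarith
    qed
  qed
  then show ?thesis using ge by (meson order_trans)
qed

section \<open>Covering\<close>

text \<open>Every point is covered by two nested linear programs. A minimiser of the sum of the labels r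
  has integer potentials x; a minimiser of the local height at x among the solutions supported on
  the arcs tight for x then has potentials y. Potentials exist because shifting mass around a cycle
  of positive cost would improve the solution.\<close>

definition feasible :: "nat \<Rightarrow> (nat \<times> nat \<times> int) set \<Rightarrow> (coord \<Rightarrow> real) \<Rightarrow> (nat \<times> nat \<times> int \<Rightarrow> real) set" where
  "feasible N Z p = {\<phi>. (\<forall>a. 0 \<le> \<phi> a) \<and> (\<forall>a. a \<notin> Z \<longrightarrow> \<phi> a = 0) \<and>
     (\<forall>c. (\<Sum>a\<in>arcs N. \<phi> a * arc_pt a c) = p c)}"

lemma feasibleD:
  assumes "\<phi> \<in> feasible N Z p"
  shows "0 \<le> \<phi> a" "a \<notin> Z \<Longrightarrow> \<phi> a = 0" "(\<Sum>a\<in>arcs N. \<phi> a * arc_pt a c) = p c"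
  using assms unfolding feasible_def by blast+

lemma sum_arc_pt_E: "a \<in> arcs N \<Longrightarrow> (\<Sum>k\<in>{1..4}. arc_pt a (E k)) = 1"
  by (cases a) (auto simp: arcs_def sum.delta)

lemma feasible_total:
  assumes "\<phi> \<in> feasible N Z p"
  shows "(\<Sum>a\<in>arcs N. \<phi> a) = (\<Sum>k\<in>{1..4}. p (E k))"
proof -
  have "(\<Sum>k\<in>{1..4}. p (E k)) = (\<Sum>k\<in>{1..4}. \<Sum>a\<in>arcs N. \<phi> a * arc_pt a (E k))"
    using assms by (simp add: feasible_def)
  also have "\<dots> = (\<Sum>a\<in>arcs N. \<phi> a * (\<Sum>k\<in>{1..4}. arc_pt a (E k)))"
    by (subst sum.swap) (simp only: sum_distrib_left)
  also have "\<dots> = (\<Sum>a\<in>arcs N. \<phi> a)"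
    by (intro sum.cong refl) (simp add: sum_arc_pt_E del: One_nat_def)
  finally show ?thesis by simp
qed

text \<open>The \<open>E\<close> coordinates of \<open>p\<close> fix the total mass, so feasible
  weights form a closed subset of a product of compact intervals, with {0} at each of the infinitely
  many triples outside \<open>Z\<close>.\<close>

lemma feasible_compact:
  assumes Z: "Z \<subseteq> arcs N"
  shows "compact (feasible N Z p)"
proof -
  define B where "B = (\<Sum>k\<in>{1..4}. p (E k))"
  define K where "K = (PiE UNIV (\<lambda>a. if a \<in> Z then {0..B} else {0}) :: (nat \<times> nat \<times> int \<Rightarrow> real) set)"
  have "compactin (product_topology (\<lambda>_. euclidean) UNIV) K"
    unfolding K_def by (simp add: compactin_PiE)
  then have K: "compact K" by (simp add: euclidean_product_topology)
  have "\<phi> a \<le> B" if "\<phi> \<in> feasible N Z p" "a \<in> arcs N" for \<phi> a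
  proof -
    have "\<phi> a \<le> (\<Sum>a\<in>arcs N. \<phi> a)" using that by (intro member_le_sum) (auto simp: feasible_def)
    then show ?thesis using feasible_total[OF that(1)] by (simp add: B_def)
  qed
  then have "feasible N Z p \<subseteq> K" using Z unfolding K_def by (auto simp: feasible_def PiE_iff)
  moreover have "closed (feasible N Z p)"
    unfolding feasible_def
    by (intro closed_Collect_conj closed_Collect_all closed_Collect_imp open_Collect_const closed_Collect_le
        closed_Collect_eq continuous_intros) simp_all
  ultimately show ?thesis using compact_Int_closed[OF K] by (metis inf.absorb_iff2)
qed

lemma optimum_exists:
  assumes "Z \<subseteq> arcs N" "feasible N Z p \<noteq> {}"
  obtains \<phi> where "\<phi> \<in> feasible N Z p"
    "\<And>\<mu>. \<mu> \<in> feasible N Z p \<Longrightarrow> (\<Sum>a\<in>arcs N. \<kappa> a * \<phi> a) \<le> (\<Sum>a\<in>arcs N. \<kappa> a * \<mu> a)"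
proof -
  have "continuous_on (feasible N Z p) (\<lambda>\<mu>. \<Sum>a\<in>arcs N. \<kappa> a * \<mu> a)"
    
    by (intro continuous_intros continuous_on_subset[OF continuous_on_product_coordinates subset_UNIV])
  from continuous_attains_inf[OF feasible_compact[OF assms(1)] assms(2) this]
  show thesis using that by blast
qed

text \<open>Mass \<open>e\<close> is moved from every arc of \<open>C\<close> to its reversal. The f
  coordinates do not change, as both points lie on the same f, nor do the \<open>E\<close>
  coordinates, as \<open>C\<close> is balanced. The cost drops by 2e times the cost of
  \<open>C\<close>.\<close>

lemma optimum_cycle:
  fixes \<kappa> :: "nat \<times> nat \<times> int \<Rightarrow> real"
  assumes Z: "Z \<subseteq> arcs N" and feas: "\<phi> \<in> feasible N Z p"
    and opt: "\<And>\<mu>. \<mu> \<in> feasible N Z p \<Longrightarrow> (\<Sum>a\<in>arcs N. \<kappa> a * \<phi> a) \<le> (\<Sum>a\<in>arcs N. \<kappa> a * \<mu> a)"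
    and anti: "\<And>a. a \<in> arcs N \<Longrightarrow> \<kappa> (arc_rev a) = - \<kappa> a"
    and C: "finite C" "\<And>a. a \<in> C \<Longrightarrow> \<phi> a > 0" "\<And>a. a \<in> C \<Longrightarrow> arc_rev a \<in> Z"
    and bal: "\<And>k. (\<Sum>a\<in>C. if fst a = k then 1 else 0 :: real) = (\<Sum>a\<in>C. if fst (snd a) = k then 1 else 0)"
  shows "(\<Sum>a\<in>C. \<kappa> a) \<le> 0"
proof (rule ccontr)
  assume pos: "\<not> ?thesis"
  then have "C \<noteq> {}" by auto
  have CZ: "C \<subseteq> Z"
  proof
    fix a assume "a \<in> C"
    then show "a \<in> Z" using C(2)[of a] feasibleD(2)[OF feas, of a] by force
  qed
  then have CA: "C \<subseteq> arcs N" using Z by blast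
  define e where "e = Min (\<phi> ` C)"
  have e: "e > 0" "\<And>a. a \<in> C \<Longrightarrow> e \<le> \<phi> a"
    unfolding e_def using C(1,2) \<open>C \<noteq> {}\<close> by auto
  define \<mu> where "\<mu> = (\<lambda>a. \<phi> a - (if a \<in> C then e else 0) + (if arc_rev a \<in> C then e else 0))"
  have sum1: "(\<Sum>a\<in>arcs N. f a * (if a \<in> C then e else 0)) = e * (\<Sum>a\<in>C. f a)" for f
  proof -
    have "(\<Sum>a\<in>arcs N. f a * (if a \<in> C then e else 0)) = (\<Sum>a\<in>C. e * f a)"
      using CA by (intro sum.mono_neutral_cong_right) auto
    then show ?thesis by (simp add: sum_distrib_left)
  qed
  have sum2: "(\<Sum>a\<in>arcs N. f a * (if arc_rev a \<in> C then e else 0)) = e * (\<Sum>a\<in>C. f (arc_rev a))" for f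
  proof -
    have "(\<Sum>a\<in>arcs N. f a * (if arc_rev a \<in> C then e else 0)) = (\<Sum>a\<in>arcs N. f (arc_rev a) * (if a \<in> C then e else 0))"
      by (rule sum.reindex_bij_witness[of _ arc_rev arc_rev]) auto
    then show ?thesis using sum1 by simp
  qed
  have sum: "(\<Sum>a\<in>arcs N. f a * \<mu> a) = (\<Sum>a\<in>arcs N. f a * \<phi> a) - e * (\<Sum>a\<in>C. f a - f (arc_rev a))" for f
  proof -
    have "(\<Sum>a\<in>arcs N. f a * \<mu> a) = (\<Sum>a\<in>arcs N. f a * \<phi> a) - (\<Sum>a\<in>arcs N. f a * (if a \<in> C then e else 0))
        + (\<Sum>a\<in>arcs N. f a * (if arc_rev a \<in> C then e else 0))"
      unfolding \<mu>_def sum_subtractf[symmetric] sum.distrib[symmetric] by (intro sum.cong refl) (simp add: algebra_simps)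
    then show ?thesis unfolding sum1 sum2 by (simp add: sum_subtractf algebra_simps)
  qed
  have "\<mu> \<in> feasible N Z p"
    unfolding feasible_def
  proof (intro CollectI conjI allI impI)
    show "0 \<le> \<mu> a" for a using e(1) e(2)[of a] feasibleD(1)[OF feas, of a] by (auto simp: \<mu>_def)
    show "\<mu> a = 0" if "a \<notin> Z" for a
    proof -
      have "a \<notin> C" "arc_rev a \<notin> C" using that CZ C(3)[of "arc_rev a"] by auto
      then show ?thesis using feasibleD(2)[OF feas that] by (simp add: \<mu>_def)
    qed
    show "(\<Sum>a\<in>arcs N. \<mu> a * arc_pt a c) = p c" for c
    proof -
      have "(\<Sum>a\<in>C. arc_pt a c - arc_pt (arc_rev a) c) = 0"
      proof (cases c)
        case (E k)
        have "arc_pt a (E k) = (if fst a = k then 1 else 0)" "arc_pt (arc_rev a) (E k) = (if fst (snd a) = k then 1 else 0)" for a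
          by (cases a; simp)+
        then show ?thesis using bal[of k] by (simp add: E sum_subtractf)
      next
        case (F i j r)
        have "arc_pt a c - arc_pt (arc_rev a) c = 0" if "a \<in> C" for a
        proof -
          obtain u v s where a: "a = (u, v, s)" by (cases a)
          then have "u \<noteq> v" using that CA by (auto simp: arcs_def)
          then show ?thesis by (auto simp: a F edge_pt_F)
        qed
        then show ?thesis by simp
      qed
      moreover have "(\<Sum>a\<in>arcs N. \<phi> a * arc_pt a c) = p c" using feas by (simp add: feasible_def)
      ultimately show ?thesis using sum[of "\<lambda>a. arc_pt a c"] by (simp add: mult.commute)
    qed
  qed
  from opt[OF this] have "e * (\<Sum>a\<in>C. \<kappa> a - \<kappa> (arc_rev a)) \<le> 0" unfolding sum by simp
  moreover have "(\<Sum>a\<in>C. \<kappa> a - \<kappa> (arc_rev a)) = 2 * (\<Sum>a\<in>C. \<kappa> a)"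
  proof -
    have "(\<Sum>a\<in>C. \<kappa> a - \<kappa> (arc_rev a)) = (\<Sum>a\<in>C. 2 * \<kappa> a)"
      using anti CA by (intro sum.cong) auto
    then show ?thesis by (simp add: sum_distrib_left)
  qed
  moreover have "e * (2 * (\<Sum>a\<in>C. \<kappa> a)) > 0" using e(1) pos by simp
  ultimately show False by simp
qed

text \<open>Only an arc whose reversal is allowed can give up mass, so only such arcs yield
  constraints. In the second program this leaves the arcs with r < x i - x j free, as in the
  definition of \<open>cell\<close>.\<close>

lemma optimum_potentials:
  fixes \<kappa> :: "nat \<times> nat \<times> int \<Rightarrow> int"
  assumes Z: "Z \<subseteq> arcs N" and feas: "\<phi> \<in> feasible N Z p"
    and opt: "\<And>\<mu>. \<mu> \<in> feasible N Z p \<Longrightarrow> (\<Sum>a\<in>arcs N. real_of_int (\<kappa> a) * \<phi> a) \<le> (\<Sum>a\<in>arcs N. real_of_int (\<kappa> a) * \<mu> a)"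
    and anti: "\<And>a. a \<in> arcs N \<Longrightarrow> \<kappa> (arc_rev a) = - \<kappa> a"
  shows "\<exists>x. \<forall>i j r. (i, j, r) \<in> arcs N \<longrightarrow> \<phi> (i, j, r) > 0 \<longrightarrow> arc_rev (i, j, r) \<in> Z \<longrightarrow> \<kappa> (i, j, r) \<le> x i - x j"
proof -
  \<comment> \<open>\<open>S\<close> keeps the cost of an arc and forgets its label, since parallel
    arcs constrain the same difference.\<close>
  define S where "S = (\<lambda>i j w. \<exists>r. w = \<kappa> (i, j, r) \<and> (i, j, r) \<in> arcs N \<and> \<phi> (i, j, r) > 0 \<and> arc_rev (i, j, r) \<in> Z)"
  define M where "M = Max (insert 0 ((\<lambda>a. \<bar>\<kappa> a\<bar>) ` arcs N))"
  have cyc: "(\<Sum>a\<in>C. \<kappa> a) \<le> 0"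
    if "finite C" "\<forall>a\<in>C. \<phi> a > 0 \<and> arc_rev a \<in> Z"
      "\<And>k. (\<Sum>a\<in>C. if fst a = k then 1 else 0 :: real) = (\<Sum>a\<in>C. if fst (snd a) = k then 1 else 0)" for C
  proof -
    have "(\<Sum>a\<in>C. real_of_int (\<kappa> a)) \<le> 0"
      by (rule optimum_cycle[OF Z feas opt _ that(1) _ _ that(3)]) (use anti that(2) in auto)
    then have "real_of_int (\<Sum>a\<in>C. \<kappa> a) \<le> 0" by simp
    then show ?thesis by (simp only: of_int_le_0_iff)
  qed
  have "\<exists>x. \<forall>i\<in>{1..4}. \<forall>j\<in>{1..4}. i \<noteq> j \<longrightarrow> (\<forall>r. S i j r \<longrightarrow> r \<le> x i - x j)"
  proof (rule potentials_exist[of S M])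
    show "\<bar>w\<bar> \<le> M" if "S i j w" for i j w
      using that unfolding S_def M_def by (auto intro!: Max_ge)
    show "w1 + w2 \<le> 0" if d: "i \<noteq> j" and S: "S i j w1" "S j i w2" for i j w1 w2
    proof -
      obtain r s where "w1 = \<kappa> (i, j, r)" "w2 = \<kappa> (j, i, s)"
        "\<forall>a\<in>{(i, j, r), (j, i, s)}. \<phi> a > 0 \<and> arc_rev a \<in> Z"
        using S unfolding S_def by auto
      then show ?thesis using cyc[of "{(i, j, r), (j, i, s)}"] d by simp
    qed
    show "w1 + w2 + w3 \<le> 0" if d: "i \<noteq> j" "j \<noteq> k" "k \<noteq> i" and S: "S i j w1" "S j k w2" "S k i w3" for i j k w1 w2 w3
    proof -
      obtain r s t where "w1 = \<kappa> (i, j, r)" "w2 = \<kappa> (j, k, s)" "w3 = \<kappa> (k, i, t)"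
        "\<forall>a\<in>{(i, j, r), (j, k, s), (k, i, t)}. \<phi> a > 0 \<and> arc_rev a \<in> Z"
        using S unfolding S_def by auto
      then show ?thesis using cyc[of "{(i, j, r), (j, k, s), (k, i, t)}"] d by simp
    qed
    show "w1 + w2 + w3 + w4 \<le> 0" if d: "i \<noteq> j" "i \<noteq> k" "i \<noteq> l" "j \<noteq> k" "j \<noteq> l" "k \<noteq> l"
      and S: "S i j w1" "S j k w2" "S k l w3" "S l i w4" for i j k l w1 w2 w3 w4
    proof -
      obtain r s t u where "w1 = \<kappa> (i, j, r)" "w2 = \<kappa> (j, k, s)" "w3 = \<kappa> (k, l, t)" "w4 = \<kappa> (l, i, u)"
        "\<forall>a\<in>{(i, j, r), (j, k, s), (k, l, t), (l, i, u)}. \<phi> a > 0 \<and> arc_rev a \<in> Z"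
        using S unfolding S_def by auto
      then show ?thesis using cyc[of "{(i, j, r), (j, k, s), (k, l, t), (l, i, u)}"] d by simp
    qed
  qed
  then obtain x where x: "\<And>i j w. i \<in> {1..4} \<Longrightarrow> j \<in> {1..4} \<Longrightarrow> i \<noteq> j \<Longrightarrow> S i j w \<Longrightarrow> w \<le> x i - x j" by blast
  show ?thesis
  proof (intro exI[of _ x] allI impI)
    fix i j r assume a: "(i, j, r) \<in> arcs N" "\<phi> (i, j, r) > 0" "arc_rev (i, j, r) \<in> Z"
    then have "S i j (\<kappa> (i, j, r))" unfolding S_def by blast
    then show "\<kappa> (i, j, r) \<le> x i - x j" using a(1) by (intro x) (auto simp: arcs_def)
  qed
qed

lemma tiling_covers:
  assumes p: "p \<in> conv (Pi_set N)"
  shows "\<exists>\<sigma>\<in>tiling b N. p \<in> conv \<sigma>"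
proof -
  obtain \<mu> where \<mu>: "\<And>x. 0 \<le> \<mu> x" "(\<Sum>x\<in>Pi_set N. \<mu> x) = 1" "\<And>c. p c = (\<Sum>x\<in>Pi_set N. \<mu> x * x c)"
    by (rule conv_subset_Pi[OF subset_refl p]) (rule that)
  have "(\<lambda>a. if a \<in> arcs N then \<mu> (arc_pt a) else 0) \<in> feasible N (arcs N) p"
    unfolding feasible_def using \<mu>(1) by (auto simp: \<mu>(3) sum_Pi_set intro!: sum.cong)
  then have "feasible N (arcs N) p \<noteq> {}" by blast
  from optimum_exists[OF subset_refl this, of "\<lambda>a. real_of_int (snd (snd a))"]
  obtain l1 where l1: "l1 \<in> feasible N (arcs N) p"
    "\<And>\<mu>. \<mu> \<in> feasible N (arcs N) p \<Longrightarrow>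
      (\<Sum>a\<in>arcs N. real_of_int (snd (snd a)) * l1 a) \<le> (\<Sum>a\<in>arcs N. real_of_int (snd (snd a)) * \<mu> a)" by blast
  have "snd (snd (arc_rev a)) = - snd (snd a)" for a by (cases a) simp
  from optimum_potentials[OF subset_refl l1 this]
  obtain x where x: "\<And>i j r. (i, j, r) \<in> arcs N \<Longrightarrow> l1 (i, j, r) > 0 \<Longrightarrow> r \<le> x i - x j"
    unfolding arc_rev_arcs snd_conv by blast
  define Z where "Z = {(i, j, r). (i, j, r) \<in> arcs N \<and> r \<le> x i - x j}"
  have Z: "Z \<subseteq> arcs N" by (auto simp: Z_def)
  have zero: "l1 a = 0" if "a \<notin> Z" for a
  proof (cases "a \<in> arcs N")
    case True
    obtain i j r where a: "a = (i, j, r)" by (cases a)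
    then have "\<not> l1 a > 0" using that True x[of i j r] by (auto simp: Z_def)
    then show ?thesis using feasibleD(1)[OF l1(1), of a] by simp
  next
    case False
    then show ?thesis by (rule feasibleD(2)[OF l1(1)])
  qed
  have "l1 \<in> feasible N Z p"
    unfolding feasible_def using feasibleD(1,3)[OF l1(1)] zero by blast
  then have ne: "feasible N Z p \<noteq> {}" by blast
  \<comment> \<open>The height is 0 off the tight arcs, which keeps \<open>\<kappa>\<close>
    antisymmetric. There one of an arc and its reversal is excluded by \<open>Z\<close>, so the mass
    of both is already fixed by \<open>p\<close>.\<close>
  define \<kappa> where "\<kappa> = (\<lambda>(i, j, r). if r = x i - x j then local_weight b x i j else 0)"
  from optimum_exists[OF Z ne, of "\<lambda>a. real_of_int (\<kappa> a)"]
  obtain l2 where l2: "l2 \<in> feasible N Z p"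
    "\<And>\<mu>. \<mu> \<in> feasible N Z p \<Longrightarrow> (\<Sum>a\<in>arcs N. real_of_int (\<kappa> a) * l2 a) \<le> (\<Sum>a\<in>arcs N. real_of_int (\<kappa> a) * \<mu> a)"
    by blast
  have "\<kappa> (arc_rev a) = - \<kappa> a" for a
  proof -
    obtain i j r where a: "a = (i, j, r)" by (cases a)
    show ?thesis using local_weight_antisym[of b x j i] by (auto simp: a \<kappa>_def)
  qed
  from optimum_potentials[OF Z l2 this]
  obtain y where y: "\<And>i j r. (i, j, r) \<in> arcs N \<Longrightarrow> l2 (i, j, r) > 0 \<Longrightarrow> arc_rev (i, j, r) \<in> Z \<Longrightarrow>
      \<kappa> (i, j, r) \<le> y i - y j" by blast
  define \<sigma> where "\<sigma> = arc_pt ` {a \<in> arcs N. l2 a > 0}"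
  have "\<sigma> \<subseteq> cell b N x y"
  proof
    fix q assume "q \<in> \<sigma>"
    then obtain i j r where a: "(i, j, r) \<in> arcs N" "l2 (i, j, r) > 0" "q = edge_pt i j r"
      unfolding \<sigma>_def by auto
    have "(i, j, r) \<in> Z" using l2(1) a(2) by (force simp: feasible_def)
    then have "r \<le> x i - x j" by (simp add: Z_def)
    moreover have "local_weight b x i j \<le> y i - y j" if r: "r = x i - x j"
    proof -
      have "arc_rev (i, j, r) \<in> Z" using a(1) r by (auto simp: Z_def arcs_def)
      from y[OF a(1,2) this] show ?thesis using r by (simp add: \<kappa>_def)
    qed
    ultimately show "q \<in> cell b N x y" unfolding cell_def using a by force
  qed
  then have "\<sigma> \<in> tiling b N" by (auto simp: tiling_def)
  moreover have "p \<in> conv \<sigma>"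
  proof -
    define \<nu> where "\<nu> = (\<lambda>q. if q \<in> Pi_set N then l2 (the_inv_into (arcs N) arc_pt q) else 0)"
    have \<nu>: "\<nu> (arc_pt a) = l2 a" if "a \<in> arcs N" for a
      using that by (simp add: \<nu>_def Pi_set_eq the_inv_into_f_f[OF inj_arc_pt] del: arc_pt_simp)
    show ?thesis
    proof (rule conv_subset_PiI[of _ N \<nu>])
      show "\<sigma> \<subseteq> Pi_set N" by (auto simp: \<sigma>_def Pi_set_eq)
      show "0 \<le> \<nu> q" for q using feasibleD(1)[OF l2(1)] by (simp add: \<nu>_def)
      show "\<nu> q = 0" if "q \<in> Pi_set N" "q \<notin> \<sigma>" for q
      proof -
        obtain a where a: "a \<in> arcs N" "q = arc_pt a" using \<open>q \<in> Pi_set N\<close> unfolding Pi_set_eq by blast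
        then have "\<not> l2 a > 0" using that(2) unfolding \<sigma>_def by blast
        moreover have "l2 a \<ge> 0" using feasibleD(1)[OF l2(1)] .
        ultimately show ?thesis using \<nu> a by simp
      qed
      show coord: "p c = (\<Sum>q\<in>Pi_set N. \<nu> q * q c)" for c
        unfolding sum_Pi_set using l2(1) by (simp add: feasible_def \<nu>)
      have "(\<Sum>q\<in>Pi_set N. \<nu> q) = (\<Sum>a\<in>arcs N. l2 a)" unfolding sum_Pi_set by (simp add: \<nu>)
      also have "\<dots> = (\<Sum>a\<in>arcs N. l1 a)" using feasible_total[OF l2(1)] feasible_total[OF l1(1)] by simp
      also have "\<dots> = (\<Sum>a\<in>arcs N. \<mu> (arc_pt a))"
        using feasible_total[OF l1(1)] feasible_total[OF \<open>(\<lambda>a. if a \<in> arcs N then \<mu> (arc_pt a) else 0) \<in> feasible N (arcs N) p\<close>]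
        by simp
      also have "\<dots> = 1" using \<mu>(2) by (simp add: sum_Pi_set)
      finally show "(\<Sum>q\<in>Pi_set N. \<nu> q) = 1" .
    qed
  qed
  ultimately show ?thesis by blast
qed

section \<open>The two triangulations and their components\<close>

lemma tiling_triangulation:
  assumes b: "b = 1 \<or> b = -1"
  shows "triangulation (Pi_set N) (tiling b N)"
  unfolding triangulation_def
proof (intro conjI ballI allI impI)
  show "is_simplex (Pi_set N) \<sigma>" if "\<sigma> \<in> tiling b N" for \<sigma> by (rule tiling_simplex[OF b that])
  show "G \<in> tiling b N" if "\<sigma> \<in> tiling b N" "G \<subseteq> \<sigma>" for \<sigma> G by (rule tiling_down[OF that])
  show "\<exists>G. is_face \<sigma> G \<and> is_face \<sigma>' G \<and> conv \<sigma> \<inter> conv \<sigma>' = conv G"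
    if "\<sigma> \<in> tiling b N" "\<sigma>' \<in> tiling b N" for \<sigma> \<sigma>'
    using subset_simplex_face_Pi[OF tiling_simplex[OF b that(1)], of "\<sigma> \<inter> \<sigma>'"]
      subset_simplex_face_Pi[OF tiling_simplex[OF b that(2)], of "\<sigma> \<inter> \<sigma>'"] tiling_inter[OF b that]
    by (intro exI[of _ "\<sigma> \<inter> \<sigma>'"]) simp
  show "\<Union> (conv ` tiling b N) = conv (Pi_set N)"
  proof
    show "conv (Pi_set N) \<subseteq> \<Union> (conv ` tiling b N)" using tiling_covers by fast
    show "\<Union> (conv ` tiling b N) \<subseteq> conv (Pi_set N)"
    proof (rule UN_least, rule subsetI)
      fix \<sigma> p assume "\<sigma> \<in> tiling b N" and p: "p \<in> conv \<sigma>"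
      then have "\<sigma> \<subseteq> Pi_set N" using tiling_simplex[OF b] by (auto simp: is_simplex_def)
      then obtain \<mu> where "\<And>x. 0 \<le> \<mu> x" "(\<Sum>x\<in>Pi_set N. \<mu> x) = 1" "\<And>c. p c = (\<Sum>x\<in>Pi_set N. \<mu> x * x c)"
        by (rule conv_subset_Pi[OF _ p]) (rule that)
      then show "p \<in> conv (Pi_set N)" by (intro conv_subset_PiI[of _ _ \<mu>]) auto
    qed
  qed
qed

text \<open>If a cell contained this half, telescoping would make its three arcs tight, so the
  vertex of the cell would lie on the same line and the heights along the half would sum to at most
  0. But along the half oriented by \<open>line_sign\<close> this sum is positive.\<close>

lemma tiling_signs:
  assumes b: "b = 1 \<or> b = -1"
  shows "signs b N (tiling b N)"
  unfolding signs_def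
proof (intro allI impI ballI notI)
  fix x l assume box: "in_box N x" and l: "l \<in> {1..4}" and mem: "oriented_tri (line_sign b x l) x l \<in> tiling b N"
  then obtain x' y where sub: "oriented_tri (line_sign b x l) x l \<subseteq> cell b N x' y" unfolding tiling_def by blast
  obtain i j k where f: "face_adj l = (i, j, k)" by (cases "face_adj l")
  then have d: "i \<in> {1..4}" "j \<in> {1..4}" "k \<in> {1..4}" "i \<noteq> j" "j \<noteq> k" "k \<noteq> i" "l \<noteq> i" "l \<noteq> j" "l \<noteq> k"
    using l unfolding index_cases by (auto simp: face_adj_def split: if_splits)
  have W: "local_weight b x i j + local_weight b x j k + local_weight b x k i = face_weight b x l" for x
    using l f unfolding index_cases by (elim disjE) (auto simp: face_adj_def local_weight_def local_weight_half_def face_weight_4)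
  have "{i, j, k, l} = {1..4}" using d l by (intro card_subset_eq) auto
  then have m: "m = i \<or> m = j \<or> m = k" if "m \<in> {1..4}" "m \<noteq> l" for m
    using that by blast
  have eps_eq: "line_sign b x' l = line_sign b x l" if "x' i - x' j = x i - x j" "x' j - x' k = x j - x k"
  proof (rule line_sign_cong[OF _ l])
    fix u v assume "u \<in> {1..4}" "v \<in> {1..4}" "u \<noteq> l" "v \<noteq> l"
    then show "x' u - x' v = x u - x v" using m[of u] m[of v] that by auto
  qed
  from line_sign_cases[OF b, of x l] show False
  proof
    assume s: "line_sign b x l = 1"
    then have "edge_pt i j (x i - x j) \<in> cell b N x' y" "edge_pt j k (x j - x k) \<in> cell b N x' y" "edge_pt k i (x k - x i) \<in> cell b N x' y"
      using sub by (auto simp: oriented_tri_def tri_pos_def f)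
    note c = edge_pt_in_cell[OF this(1) d(4)] edge_pt_in_cell[OF this(2) d(5)] edge_pt_in_cell[OF this(3) d(6)]
    have eq: "x' i - x' j = x i - x j" "x' j - x' k = x j - x k" "x' k - x' i = x k - x i"
      using c(2,5,8) by linarith+
    have "local_weight b x' i j + local_weight b x' j k + local_weight b x' k i \<le> 0" using c(3,6,9) eq by linarith
    then have "face_weight b x' l \<le> 0" by (simp add: W)
    moreover have "face_weight b x' l > 0" using face_weight_signs(1)[OF b l] eps_eq[OF eq(1,2)] s by simp
    ultimately show False by simp
  next
    assume s: "line_sign b x l = -1"
    then have "edge_pt j i (x j - x i) \<in> cell b N x' y" "edge_pt k j (x k - x j) \<in> cell b N x' y" "edge_pt i k (x i - x k) \<in> cell b N x' y"
      using sub by (auto simp: oriented_tri_def tri_neg_def f)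
    note c = edge_pt_in_cell[OF this(1) d(4)[symmetric]] edge_pt_in_cell[OF this(2) d(5)[symmetric]] edge_pt_in_cell[OF this(3) d(6)[symmetric]]
    have eq: "x' i - x' j = x i - x j" "x' j - x' k = x j - x k" "x' k - x' i = x k - x i"
      using c(2,5,8) by linarith+
    have "local_weight b x' j i + local_weight b x' k j + local_weight b x' i k \<le> 0" using c(3,6,9) eq by linarith
    then have "face_weight b x' l \<ge> 0"
      using W[of x'] local_weight_antisym[of b x' j i] local_weight_antisym[of b x' k j] local_weight_antisym[of b x' i k] by linarith
    moreover have "face_weight b x' l < 0" using face_weight_signs(2)[OF b l] eps_eq[OF eq(1,2)] s by simp
    ultimately show False by simp
  qed
qed

theorem theorem4p3:
  shows "\<exists>N0::nat. \<forall>N\<ge>N0. \<not> flip_graph_connected (Pi_set N)"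
proof (intro exI[of _ 7] allI impI notI)
  fix N :: nat assume N: "7 \<le> N" and conn: "flip_graph_connected (Pi_set N)"
  have T: "triangulation (Pi_set N) (tiling 1 N)" "triangulation (Pi_set N) (tiling (- 1) N)"
    by (simp_all add: tiling_triangulation)
  then have "(tiling 1 N, tiling (- 1) N) \<in> (flip_adj (Pi_set N))\<^sup>*"
    using conn by (simp add: flip_graph_connected_def)
  then have "signs 1 N (tiling (- 1) N)"
    using signs_rtrancl[OF N, of 1] tiling_signs[of 1 N] by simp
  moreover have "signs (- 1) N (tiling (- 1) N)" by (simp add: tiling_signs)
  moreover have box: "in_box N (\<lambda>_. 0)" by (simp add: in_box_def)
  moreover have one: "(1::nat) \<in> {1..4}" by simp
  ultimately have "oriented_tri (line_sign 1 (\<lambda>_. 0) 1) (\<lambda>_. 0) 1 \<notin> tiling (- 1) N"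
    "oriented_tri (- line_sign 1 (\<lambda>_. 0) 1) (\<lambda>_. 0) 1 \<notin> tiling (- 1) N"
    unfolding signs_def line_sign_minus by blast+
  moreover have "line_sign 1 (\<lambda>_. 0) 1 = 1 \<or> line_sign 1 (\<lambda>_. 0) 1 = -1" by (simp add: line_sign_cases)
  ultimately show False using oriented_tri_iff[OF T(2) box one] by blast
qed

end
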